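(* Let $\rho\in AC([0,T];\mathcal P(\mathcal X))$ be a solution of $\partial_t\rho=L^T\rho$ with initial datum $\rho_0\in\mathcal P(\mathcal X)$, and let $\mu\in C([0,T];\mathcal P(\mathcal X))$, with $\mu|_{t=0}=\mu_0$, satisfy $$\mathscr I_L(\mu)+\mathscr H(\mu_0|\rho_0)<\infty.$$ Then for any $\lambda\in(0,1)$, $$\mathscr H(\mu_T|\rho_T)+\int_0^T\mathscr R^\lambda_L(\mu_t|\rho_t)\,dt\le\mathscr H(\mu_0|\rho_0)+\frac1\lambda\mathscr I_L(\mu).$$
   Context: $\mathcal X$ is a finite or countable set and $T>0$ is fixed. $\mathcal P(\mathcal X)$ is the set of probability measures on $\mathcal X$, viewed as a subset of $\ell^1(\mathcal X)$ with the $\ell^1$-topology. The generator $L\in\mathbb R^{\mathcal X\times\mathcal X}$ satisfies: (L1) $L(x,y)\ge0$ for $x\ne y$ and $\sum_{y}L(x,y)=0$ for all $x$; (L2) $\sup_x|L(x,x)|<\infty$; (L3) $L$ is irreducible (for all $x\neq y$ there is a finite chain $x=x_0,\dots,x_m=y$ with $L(x_k,x_{k+1})>0$). $L^T$ is its transpose: $(L^T\rho)(x)=\sum_yL(y,x)\rho(y)$. $AC([0,T];\mathcal P(\mathcal X))$ is the set of curves $[0,T]\to\mathcal P(\mathcal X)$ absolutely continuous with respect to the $\ell^1(\mathcal X)$-norm; they have a derivative $\partial_t\mu_t\in\ell^1(\mathcal X)$ for a.e. $t$. Relative entropy: $\mathscr H(\mu|\rho)=\sum_{x}f(x)\log f(x)\,\rho(x)$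 if $\mu\ll\rho$ with $f=d\mu/d\rho$ (with $0\log0=0$), and $+\infty$ otherwise. Hamiltonian and Lagrangian, for $\mu\in\mathcal P(\mathcal X)$, $\xi\in\ell^\infty(\mathcal X)$, $s\in\ell^1(\mathcal X)$: $\mathcal H(\mu,\xi)=\sum_{x,y}\mu(x)L(x,y)[e^{\xi(y)-\xi(x)}-1]$ and $\mathcal L(\mu,s)=\sup_{\xi\in\ell^\infty(\mathcal X)}\{\sum_x\xi(x)s(x)-\mathcal H(\mu,\xi)\}$. Rate functional, for $\mu\in C([0,T];\mathcal P(\mathcal X))$: $\mathscr I_L(\mu)=\int_0^T\mathcal L(\mu_t,\partial_t\mu_t)\,dt$ if $\mu\in AC([0,T];\mathcal P(\mathcal X))$, and $\mathscr I_L(\mu)=+\infty$ otherwise. Generalised relative Fisher Information, for $\lambda\in(0,1)$ and $\mu,\rho\in\mathcal P(\mathcal X)$: $\mathscr R^\lambda_L(\mu|\rho)=\sum_{x,y\in\mathcal X}L(x,y)\psi_\lambda(x,y)\in[0,\infty]$ (with $0\cdot\infty=0$), where - $\psi_\lambda(x,y)=\frac{\mu(y)}{\rho(y)}\rho(x)-\mu(x)-\frac1\lambda\Big(\mu(x)^{1-\lambda}\rho(x)^\lambda\big(\frac{\mu(y)}{\rho(y)}\big)^\lambda-\mu(x)\Big)$ if $\rho(y)>0$ and $\rho(x)>0$; - $\psi_\lambda(x,y)=+\infty$ if $\rho(y)=0$, $\rho(x)>0$ and $\mu(y)>0$; - $\psi_\lambda(x,y)=0$ otherwise. (The terms with $x=y$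 vanish.) *)

theory Defs
  imports "HOL-Probability.Probability"
begin

text \<open>
  The state space is a type \<open>'a :: countable\<close>, so that \<open>'a pmf\<close> is the set of all
  probability measures on it. Quantities with values in \<open>[0, \<infinity>]\<close> are of type \<^typ>\<open>ereal\<close>;
  time integrals are Lebesgue integrals of the corresponding \<^typ>\<open>ennreal\<close>-valued functions.
  The conversion by \<^const>\<open>e2ennreal\<close> truncates negative values, which do not occur here:
  see \<open>lagrangian_nonneg\<close> and \<open>fisher_info_nonneg\<close> below.
\<close>

definition generator :: "('a::countable \<Rightarrow> 'a \<Rightarrow> real) \<Rightarrow> bool" where
  "generator L \<longleftrightarrow>
     (\<forall>x y. x \<noteq> y \<longrightarrow> 0 \<le> L x y) \<and>
     (\<forall>x. (L x has_sum 0) UNIV) \<and>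
     bdd_above (range (\<lambda>x. \<bar>L x x\<bar>)) \<and>
     (\<forall>x y. x \<noteq> y \<longrightarrow> (\<lambda>u v. 0 < L u v)\<^sup>*\<^sup>* x y)"

definition transpose_gen :: "('a::countable \<Rightarrow> 'a \<Rightarrow> real) \<Rightarrow> ('a \<Rightarrow> real) \<Rightarrow> 'a \<Rightarrow> real" where
  "transpose_gen L v x = (\<Sum>\<^sub>\<infinity>y. L y x * v y)"

definition l1_norm :: "('a \<Rightarrow> real) \<Rightarrow> real" where
  "l1_norm v = (\<Sum>\<^sub>\<infinity>x. \<bar>v x\<bar>)"

definition l1_dist :: "'a pmf \<Rightarrow> 'a pmf \<Rightarrow> real" where
  "l1_dist p q = l1_norm (\<lambda>x. pmf p x - pmf q x)"

definition cont_curve :: "real \<Rightarrow> (real \<Rightarrow> 'a pmf) \<Rightarrow> bool" where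
  "cont_curve T \<mu> \<longleftrightarrow>
     (\<forall>t\<in>{0..T}. ((\<lambda>s. l1_dist (\<mu> s) (\<mu> t)) \<longlongrightarrow> 0) (at t within {0..T}))"

text \<open>Absolute continuity; \<open>I\<close> ranges over finite families of non-overlapping intervals
  \<open>[a, b]\<close>, represented by their pairs of endpoints.\<close>

definition ac_curve :: "real \<Rightarrow> (real \<Rightarrow> 'a pmf) \<Rightarrow> bool" where
  "ac_curve T \<mu> \<longleftrightarrow>
     (\<forall>\<epsilon>>0. \<exists>\<delta>>0. \<forall>I.
        finite I \<and> (\<forall>(a, b)\<in>I. 0 \<le> a \<and> a \<le> b \<and> b \<le> T) \<and>
        (\<forall>i\<in>I. \<forall>j\<in>I. i \<noteq> j \<longrightarrow> {fst i<..<snd i} \<inter> {fst j<..<snd j} = {}) \<and>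
        (\<Sum>(a, b)\<in>I. b - a) < \<delta>
        \<longrightarrow> (\<Sum>(a, b)\<in>I. l1_dist (\<mu> b) (\<mu> a)) < \<epsilon>)"

definition has_l1_deriv :: "real \<Rightarrow> (real \<Rightarrow> 'a pmf) \<Rightarrow> ('a \<Rightarrow> real) \<Rightarrow> real \<Rightarrow> bool" where
  "has_l1_deriv T \<mu> v t \<longleftrightarrow>
     (\<lambda>x. \<bar>v x\<bar>) summable_on UNIV \<and>
     ((\<lambda>s. l1_norm (\<lambda>x. (pmf (\<mu> s) x - pmf (\<mu> t) x) / (s - t) - v x)) \<longlongrightarrow> 0)
       (at t within {0..T})"

text \<open>For absolutely continuous curves the derivative exists at almost every \<open>t\<close>; its (arbitrary)
  value at the remaining \<open>t\<close> does not influence time integrals.\<close>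

definition l1_deriv :: "real \<Rightarrow> (real \<Rightarrow> 'a pmf) \<Rightarrow> real \<Rightarrow> 'a \<Rightarrow> real" where
  "l1_deriv T \<mu> t = (THE v. has_l1_deriv T \<mu> v t)"

definition forward_solution ::
  "('a::countable \<Rightarrow> 'a \<Rightarrow> real) \<Rightarrow> real \<Rightarrow> (real \<Rightarrow> 'a pmf) \<Rightarrow> bool" where
  "forward_solution L T \<rho> \<longleftrightarrow>
     ac_curve T \<rho> \<and>
     (AE t in lborel. t \<in> {0..T} \<longrightarrow> has_l1_deriv T \<rho> (transpose_gen L (pmf (\<rho> t))) t)"

text \<open>The summands of the entropy are bounded below by the summable \<open>- \<rho>(x)\<close>, so the unordered
  sum in \<^typ>\<open>ereal\<close> is the real sum if that exists and \<open>\<infinity>\<close> otherwise, as confirmed by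
  \<open>rel_entropy_summable\<close> and \<open>rel_entropy_not_summable\<close>. The convention \<open>0 log 0 = 0\<close> is automatic.\<close>

definition rel_entropy :: "'a pmf \<Rightarrow> 'a pmf \<Rightarrow> ereal" where
  "rel_entropy \<mu> \<rho> =
     (if \<forall>x. pmf \<rho> x = 0 \<longrightarrow> pmf \<mu> x = 0
      then \<Sum>\<^sub>\<infinity>x. ereal (let f = pmf \<mu> x / pmf \<rho> x in f * ln f * pmf \<rho> x)
      else \<infinity>)"

definition hamiltonian ::
  "('a::countable \<Rightarrow> 'a \<Rightarrow> real) \<Rightarrow> 'a pmf \<Rightarrow> ('a \<Rightarrow> real) \<Rightarrow> real" where
  "hamiltonian L \<mu> \<xi> = (\<Sum>\<^sub>\<infinity>(x, y). pmf \<mu> x * L x y * (exp (\<xi> y - \<xi> x) - 1))"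

definition lagrangian ::
  "('a::countable \<Rightarrow> 'a \<Rightarrow> real) \<Rightarrow> 'a pmf \<Rightarrow> ('a \<Rightarrow> real) \<Rightarrow> ereal" where
  "lagrangian L \<mu> s =
     (SUP \<xi>\<in>{\<xi>. bounded (range \<xi>)}. ereal ((\<Sum>\<^sub>\<infinity>x. \<xi> x * s x) - hamiltonian L \<mu> \<xi>))"

definition rate_functional ::
  "('a::countable \<Rightarrow> 'a \<Rightarrow> real) \<Rightarrow> real \<Rightarrow> (real \<Rightarrow> 'a pmf) \<Rightarrow> ereal" where
  "rate_functional L T \<mu> =
     (if ac_curve T \<mu>
      then enn2ereal (\<integral>\<^sup>+t\<in>{0..T}. e2ennreal (lagrangian L (\<mu> t) (l1_deriv T \<mu> t)) \<partial>lborel)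
      else \<infinity>)"

definition fisher_psi :: "real \<Rightarrow> 'a pmf \<Rightarrow> 'a pmf \<Rightarrow> 'a \<Rightarrow> 'a \<Rightarrow> ereal" where
  "fisher_psi lam \<mu> \<rho> x y =
     (if pmf \<rho> y > 0 \<and> pmf \<rho> x > 0 then
        ereal (pmf \<mu> y / pmf \<rho> y * pmf \<rho> x - pmf \<mu> x
          - 1 / lam * (pmf \<mu> x powr (1 - lam) * pmf \<rho> x powr lam
                         * (pmf \<mu> y / pmf \<rho> y) powr lam - pmf \<mu> x))
      else if pmf \<rho> y = 0 \<and> pmf \<rho> x > 0 \<and> pmf \<mu> y > 0 then \<infinity>
      else 0)"

definition fisher_info ::
  "('a::countable \<Rightarrow> 'a \<Rightarrow> real) \<Rightarrow> real \<Rightarrow> 'a pmf \<Rightarrow> 'a pmf \<Rightarrow> ereal" where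
  "fisher_info L lam \<mu> \<rho> = (\<Sum>\<^sub>\<infinity>(x, y). ereal (L x y) * fisher_psi lam \<mu> \<rho> x y)"

lemma lagrangian_nonneg: "0 \<le> lagrangian L \<mu> s"
proof -
  have "ereal ((\<Sum>\<^sub>\<infinity>x. (\<lambda>_. 0) x * s x) - hamiltonian L \<mu> (\<lambda>_. 0)) \<le> lagrangian L \<mu> s"
    unfolding lagrangian_def by (rule SUP_upper) simp
  then show ?thesis
    by (simp add: hamiltonian_def zero_ereal_def case_prod_unfold)
qed

lemma fisher_psi_nonneg:
  assumes "0 < lam" "lam < 1"
  shows "0 \<le> fisher_psi lam \<mu> \<rho> x y"
proof (cases "pmf \<rho> y > 0 \<and> pmf \<rho> x > 0")
  case True
  define m r q where "m = pmf \<mu> x" and "r = pmf \<rho> x" and "q = pmf \<mu> y / pmf \<rho> y"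
  have nn: "0 \<le> m" "0 < r" "0 \<le> q"
    using True by (auto simp: m_def r_def q_def)
  have young: "m powr (1 - lam) * (q * r) powr lam \<le> (1 - lam) * m + lam * (q * r)"
  proof (cases "m = 0 \<or> q = 0")
    case True
    then show ?thesis using nn assms by auto
  next
    case False
    then show ?thesis using nn assms by (intro Youngs_inequality_0) auto
  qed
  have "(q * r) powr lam = r powr lam * q powr lam"
    using nn by (simp add: powr_mult mult.commute)
  then have "m powr (1 - lam) * r powr lam * q powr lam - m \<le> lam * (q * r - m)"
    using young by (simp add: algebra_simps)
  then have "1 / lam * (m powr (1 - lam) * r powr lam * q powr lam - m) \<le> q * r - m"
    using assms by (simp add: field_simps)
  then show ?thesis
    using True by (simp add: fisher_psi_def m_def r_def q_def)
qed (auto simp: fisher_psi_def)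

lemma fisher_psi_diag: "0 < lam \<Longrightarrow> lam < 1 \<Longrightarrow> fisher_psi lam \<mu> \<rho> x x = 0"
  by (cases "pmf \<mu> x = 0")
    (auto simp: fisher_psi_def powr_divide zero_ereal_def simp flip: powr_add)

lemma fisher_info_nonneg:
  assumes "generator L" "0 < lam" "lam < 1"
  shows "0 \<le> fisher_info L lam \<mu> \<rho>"
  unfolding fisher_info_def
proof (rule infsum_nonneg, clarify)
  fix x y
  show "0 \<le> ereal (L x y) * fisher_psi lam \<mu> \<rho> x y"
    using assms fisher_psi_nonneg[of lam \<mu> \<rho> x y] fisher_psi_diag[of lam \<mu> \<rho> x]
    by (cases "x = y") (auto simp: generator_def)
qed

lemma rel_entropy_summable:
  fixes \<mu> \<rho> :: "'a pmf"
  defines "g \<equiv> \<lambda>x. let f = pmf \<mu> x / pmf \<rho> x in f * ln f * pmf \<rho> x"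
  assumes "\<forall>x. pmf \<rho> x = 0 \<longrightarrow> pmf \<mu> x = 0" and "g summable_on UNIV"
  shows "rel_entropy \<mu> \<rho> = ereal (\<Sum>\<^sub>\<infinity>x. g x)"
proof -
  have "((\<lambda>F. ereal (sum g F)) \<longlongrightarrow> ereal (infsum g UNIV)) (finite_subsets_at_top UNIV)"
    using has_sum_infsum[OF assms(3)] unfolding has_sum_def by (rule tendsto_ereal)
  then have "((\<lambda>x. ereal (g x)) has_sum ereal (infsum g UNIV)) UNIV"
    by (simp only: has_sum_def sum_ereal[symmetric])
  then have "(\<Sum>\<^sub>\<infinity>x. ereal (g x)) = ereal (infsum g UNIV)"
    by (rule infsumI)
  then show ?thesis
    using assms(2) by (simp add: rel_entropy_def g_def)
qed

lemma rel_entropy_not_summable: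
  fixes \<mu> \<rho> :: "'a pmf"
  defines "g \<equiv> \<lambda>x. let f = pmf \<mu> x / pmf \<rho> x in f * ln f * pmf \<rho> x"
  assumes "\<not> g summable_on UNIV"
  shows "rel_entropy \<mu> \<rho> = \<infinity>"
proof -
  have lower: "0 \<le> g x + pmf \<rho> x" for x
  proof (cases "pmf \<mu> x = 0 \<or> pmf \<rho> x = 0")
    case False
    define f where "f = pmf \<mu> x / pmf \<rho> x"
    have "0 < f" using False by (simp add: f_def pmf_pos)
    then have "ln (1 / f) \<le> 1 / f - 1" by (intro ln_le_minus_one) auto
    then have "f * (1 - 1 / f) \<le> f * ln f"
      using \<open>0 < f\<close> by (intro mult_left_mono) (auto simp: ln_div)
    then have "f - 1 \<le> f * ln f"
      using \<open>0 < f\<close> by (simp add: algebra_simps)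
    then have "- 1 * pmf \<rho> x \<le> f * ln f * pmf \<rho> x"
      using \<open>0 < f\<close> by (intro mult_right_mono) auto
    then show ?thesis by (simp add: g_def f_def Let_def)
  qed (auto simp: g_def)
  have rho_le: "sum (pmf \<rho>) F \<le> 1" if "finite F" for F
    using that measure_pmf.prob_le_1[of \<rho> F] by (simp add: measure_measure_pmf_finite)
  have rho_sum: "pmf \<rho> summable_on UNIV"
    by (rule nonneg_bdd_above_summable_on) (auto intro!: bdd_aboveI[of _ 1] rho_le)
  have not_sum: "\<not> (\<lambda>x. g x + pmf \<rho> x) summable_on UNIV"
  proof
    assume "(\<lambda>x. g x + pmf \<rho> x) summable_on UNIV"
    from summable_on_add[OF this, of "\<lambda>x. - pmf \<rho> x"] rho_sum show False
      using assms(2) by (simp add: summable_on_uminus)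
  qed
  have "((\<lambda>F. ereal (sum g F)) \<longlongrightarrow> \<infinity>) (finite_subsets_at_top UNIV)"
    unfolding tendsto_PInfty
  proof
    fix B :: real
    have "\<not> bdd_above (sum (\<lambda>x. g x + pmf \<rho> x) ` {F. F \<subseteq> UNIV \<and> finite F})"
      using nonneg_bdd_above_summable_on[of UNIV "\<lambda>x. g x + pmf \<rho> x"] lower not_sum by auto
    then obtain F where F: "finite F" "B + 1 < (\<Sum>x\<in>F. g x + pmf \<rho> x)"
      by (force simp: bdd_above_def not_le)
    have "B < sum g G" if "finite G" "F \<subseteq> G" for G
    proof -
      have "(\<Sum>x\<in>F. g x + pmf \<rho> x) \<le> (\<Sum>x\<in>G. g x + pmf \<rho> x)"
        using that lower by (intro sum_mono2) auto
      then show ?thesis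
        using F rho_le[OF that(1)] by (simp add: sum.distrib)
    qed
    then show "\<forall>\<^sub>F G in finite_subsets_at_top UNIV. ereal B < ereal (sum g G)"
      using F(1) by (auto simp: eventually_finite_subsets_at_top)
  qed
  then have "((\<lambda>x. ereal (g x)) has_sum \<infinity>) UNIV"
    by (simp only: has_sum_def sum_ereal[symmetric])
  then have "(\<Sum>\<^sub>\<infinity>x. ereal (g x)) = \<infinity>"
    by (rule infsumI)
  then show ?thesis
    by (simp add: rel_entropy_def g_def)
qed

end

theory Submission
  imports Defs
begin

text \<open>For smooth positive curves the inequality comes from one test function. The definition of the
  Lagrangian gives \<open>\<L>(\<mu>, \<mu>') \<ge> \<langle>\<xi>, \<mu>'\<rangle> - \<H>(\<mu>, \<xi>)\<close>, and for \<open>\<xi> = \<lambda> log (\<mu> / \<rho>)\<close> the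
  pairing \<open>\<langle>\<xi>, \<mu>'\<rangle>\<close> is \<open>\<lambda>\<close> times the part of the time derivative of the entropy that is due to the
  motion of \<open>\<mu>\<close>. The part due to \<open>\<rho>' = L\<^sup>T \<rho>\<close> and the Hamiltonian combine into the Fisher
  information, because the rows of \<open>L\<close> sum to zero. Division by \<open>\<lambda>\<close> and integration in time finish
  the argument.

  In general \<open>log (\<mu> / \<rho>)\<close> is unbounded, or undefined where a measure vanishes. The proof keeps the
  curves and truncates the logarithm: \<open>\<xi>\<^sub>n\<close> is \<open>log (\<mu> / \<rho>)\<close> clamped to \<open>[-n, n]\<close>. The entropy
  belonging to it, \<open>max {m \<eta> - r (e\<^sup>\<eta> - 1) | \<bar>\<eta>\<bar> \<le> n}\<close>, is a finite function of masses \<open>m, r \<ge> 0\<close>,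
  convex and Lipschitz up to and including \<open>r = 0\<close>. Three facts make this truncation work.

  First, the truncated entropy along two absolutely continuous curves is an absolutely continuous
  function of time, so it is the integral of its derivative. Its subgradient at time \<open>t\<close> bounds it
  from below at all times, with equality at \<open>t\<close>; hence the derivative, where it exists, is given by
  the subgradient (\<open>trunc_entropy_sum_derivative\<close>), and no differentiability of the truncation is
  involved.

  Second, the test function \<open>\<lambda> \<xi>\<^sub>n\<close> leaves as remainder a double sum \<open>trunc_fisher_sum\<close> whose
  summands are all nonnegative, also at points where the truncation is active
  (\<open>trunc_fisher_nonneg\<close>). So Fatou's lemma applies as \<open>n\<close> tends to infinity, once over pairs of
  states and once over time.

  Third, at almost every \<open>t\<close> a state \<open>y\<close> with \<open>\<rho>\<^sub>t(y) = 0\<close> is a minimum in time of \<open>\<rho>(y)\<close>, so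
  \<open>(L\<^sup>T \<rho>\<^sub>t)(y) = 0\<close> and there is no rate into \<open>y\<close> from the support of \<open>\<rho>\<^sub>t\<close>
  (\<open>forward_equation_vanishing\<close>). The infinite values of \<open>\<psi>\<^sub>\<lambda>\<close> therefore always carry weight zero.

  All this presupposes that an absolutely continuous curve of measures has an \<open>\<ell>\<^sup>1\<close>-derivative at
  almost every time (\<open>ac_curve_has_l1_deriv\<close>). For real functions this is the Radon-Nikodym theorem
  for the measure of the variation together with Lebesgue differentiation
  (\<open>ac_function_density\<close>). For curves, the coordinates are then differentiable almost everywhere,
  the norms of the difference quotients converge to the norm of the limit, and Scheffe's argument
  upgrades coordinatewise convergence to convergence in norm.\<close>

section \<open>Absolute continuity through families of intervals\<close>

text \<open>Degenerate intervals are excluded, so that families inside different nonoverlapping intervals are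
  disjoint as sets of pairs and sums over their union split.\<close>

definition nonoverlapping :: "real \<Rightarrow> real \<Rightarrow> (real \<times> real) set \<Rightarrow> bool" where
  "nonoverlapping a b I \<longleftrightarrow> finite I \<and> (\<forall>(u, v)\<in>I. a \<le> u \<and> u < v \<and> v \<le> b) \<and>
     (\<forall>i\<in>I. \<forall>j\<in>I. i \<noteq> j \<longrightarrow> {fst i<..<snd i} \<inter> {fst j<..<snd j} = {})"

lemma nonoverlapping_mono:
  "nonoverlapping a b I \<Longrightarrow> a' \<le> a \<Longrightarrow> b \<le> b' \<Longrightarrow> J \<subseteq> I \<Longrightarrow> nonoverlapping a' b' J"
proof -
  assume *: "nonoverlapping a b I" "a' \<le> a" "b \<le> b'" "J \<subseteq> I"
  then have I: "finite I" "\<And>p. p \<in> I \<Longrightarrow> a \<le> fst p \<and> fst p < snd p \<and> snd p \<le> b"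
    "\<And>p q. p \<in> I \<Longrightarrow> q \<in> I \<Longrightarrow> p \<noteq> q \<Longrightarrow> {fst p<..<snd p} \<inter> {fst q<..<snd q} = {}"
    by (auto simp: nonoverlapping_def)
  have "a' \<le> fst p \<and> fst p < snd p \<and> snd p \<le> b'" if "p \<in> J" for p
    using I(2)[of p] * that by force
  then show ?thesis
    using I(3) finite_subset[OF *(4) I(1)] *(4)
    unfolding nonoverlapping_def case_prod_unfold by blast
qed

lemma nonoverlapping_single: "a \<le> u \<Longrightarrow> u < v \<Longrightarrow> v \<le> b \<Longrightarrow> nonoverlapping a b {(u, v)}"
  by (simp add: nonoverlapping_def)

lemma nonoverlapping_length:
  assumes "nonoverlapping a b I" "S \<in> lmeasurable" "\<And>u v. (u, v) \<in> I \<Longrightarrow> {u<..<v} \<subseteq> S"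
  shows "(\<Sum>(u, v)\<in>I. v - u) \<le> measure lebesgue S"
proof -
  have fin: "finite I" and lt: "\<And>u v. (u, v) \<in> I \<Longrightarrow> u < v"
    using assms(1) by (auto simp: nonoverlapping_def)
  have "(\<Sum>(u, v)\<in>I. v - u) = (\<Sum>i\<in>I. measure lebesgue {fst i<..<snd i})"
    by (intro sum.cong) (auto dest: lt)
  also have "\<dots> = measure lebesgue (\<Union>i\<in>I. {fst i<..<snd i})"
    using assms(1)
    by (intro measure_UNION'[symmetric])
       (auto simp: nonoverlapping_def pairwise_def disjnt_def)
  also have "\<dots> \<le> measure lebesgue S"
    using assms(2) fin subsetD[OF assms(3)]
    by (intro measure_mono_fmeasurable) (auto simp: fmeasurableD intro!: sets.finite_UN)
  finally show ?thesis .
qed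

lemma nonoverlapping_UN:
  assumes "nonoverlapping a b J" and "\<And>u v. (u, v) \<in> J \<Longrightarrow> nonoverlapping u v (K (u, v))"
  shows "nonoverlapping a b (\<Union>j\<in>J. K j)"
    and "i \<in> J \<Longrightarrow> j \<in> J \<Longrightarrow> i \<noteq> j \<Longrightarrow> K i \<inter> K j = {}"
proof -
  have sub: "fst j \<le> fst p \<and> fst p < snd p \<and> snd p \<le> snd j" if "j \<in> J" "p \<in> K j" for j p
    using assms(2)[of "fst j" "snd j"] that by (auto simp: nonoverlapping_def)
  have dis: "{fst p<..<snd p} \<inter> {fst q<..<snd q} = {}"
    if "i \<in> J" "j \<in> J" "i \<noteq> j" "p \<in> K i" "q \<in> K j" for i j p q
  proof -
    have "{fst i<..<snd i} \<inter> {fst j<..<snd j} = {}"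
      using assms(1) that by (auto simp: nonoverlapping_def)
    moreover have "{fst p<..<snd p} \<subseteq> {fst i<..<snd i}" "{fst q<..<snd q} \<subseteq> {fst j<..<snd j}"
      using sub that by fastforce+
    ultimately show ?thesis by blast
  qed
  have "\<exists>x. x \<in> {fst p<..<snd p}" if "j \<in> J" "p \<in> K j" for j p
    using sub[OF that] dense by auto
  then show "i \<in> J \<Longrightarrow> j \<in> J \<Longrightarrow> i \<noteq> j \<Longrightarrow> K i \<inter> K j = {}"
    using dis by blast
  show "nonoverlapping a b (\<Union>j\<in>J. K j)"
    unfolding nonoverlapping_def
  proof (intro conjI ballI impI)
    show "finite (\<Union>j\<in>J. K j)"
      using assms by (auto simp: nonoverlapping_def)
    show "case p of (u, v) \<Rightarrow> a \<le> u \<and> u < v \<and> v \<le> b" if p: "p \<in> (\<Union>j\<in>J. K j)" for p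
    proof -
      obtain j where "j \<in> J" "p \<in> K j" using p by blast
      moreover have "a \<le> fst j" "snd j \<le> b"
        using assms(1) \<open>j \<in> J\<close> by (auto simp: nonoverlapping_def)
      ultimately show ?thesis using sub[of j p] by auto
    qed
    show "{fst p<..<snd p} \<inter> {fst q<..<snd q} = {}"
      if "p \<in> (\<Union>j\<in>J. K j)" "q \<in> (\<Union>j\<in>J. K j)" "p \<noteq> q" for p q
    proof -
      obtain i j where ij: "i \<in> J" "p \<in> K i" "j \<in> J" "q \<in> K j" using \<open>p \<in> _\<close> \<open>q \<in> _\<close> by blast
      show ?thesis
      proof (cases "i = j")
        case True
        then show ?thesis
          using assms(2)[of "fst i" "snd i"] ij \<open>p \<noteq> q\<close> by (auto simp: nonoverlapping_def)
      qed (use dis ij in blast)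
    qed
  qed
qed

text \<open>The \<open>\<epsilon>\<close>-\<open>\<delta>\<close> condition is stated for a function of the two endpoints of an interval: it then covers
  increments of monotone functions, of real functions and of curves in \<open>\<ell>\<^sup>1\<close> alike.\<close>

definition ac_distance :: "real \<Rightarrow> (real \<Rightarrow> real \<Rightarrow> real) \<Rightarrow> bool" where
  "ac_distance T d \<longleftrightarrow>
     (\<forall>\<epsilon>>0. \<exists>\<delta>>0. \<forall>I. nonoverlapping 0 T I \<and> (\<Sum>(u, v)\<in>I. v - u) < \<delta>
        \<longrightarrow> (\<Sum>(u, v)\<in>I. d u v) < \<epsilon>)"

locale ac_pseudometric =
  fixes T :: real and d :: "real \<Rightarrow> real \<Rightarrow> real"
  assumes nonneg: "0 \<le> d u v"
    and refl0: "d u u = 0"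
    and triangle: "d u v \<le> d u w + d w v"
    and ac: "ac_distance T d"
begin

definition total :: "(real \<times> real) set \<Rightarrow> real" where
  "total I = (\<Sum>(u, v)\<in>I. d u v)"

definition variation :: "real \<Rightarrow> real \<Rightarrow> real" where
  "variation a b = Sup (total ` Collect (nonoverlapping a b))"

text \<open>Cutting every interval of a family at \<open>b\<close> only increases the total, by the triangle inequality.
  Cut pieces may degenerate to a point, where \<open>d\<close> vanishes; only the others are kept, and on those
  the two cutting maps are injective.\<close>

lemma split_family:
  assumes I: "nonoverlapping a c I"
  obtains I1 I2 where "nonoverlapping a b I1" "nonoverlapping b c I2"
    "total I \<le> total I1 + total I2"
proof -
  \<comment> \<open>the two cutting maps; pieces outside \<open>D\<close> have degenerated to a point\<close>
  define l r where "l p = (min (fst p) b, min (snd p) b)"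
    and "r p = (max (fst p) b, max (snd p) b)" for p :: "real \<times> real"
  define D where "D = {p :: real \<times> real. fst p < snd p}"
  have fin: "finite I" using I by (simp add: nonoverlapping_def)
  have inj: "l p = l q \<Longrightarrow> l p \<in> D \<Longrightarrow> p = q" "r p = r q \<Longrightarrow> r p \<in> D \<Longrightarrow> p = q"
    if "p \<in> I" "q \<in> I" for p q
  proof -
    have dis: "p \<noteq> q \<Longrightarrow> {fst p<..<snd p} \<inter> {fst q<..<snd q} = {}"
      using I that by (auto simp: nonoverlapping_def)
    show "p = q" if "l p = l q" "l p \<in> D"
    proof (rule ccontr)
      assume "p \<noteq> q"
      from that obtain x where "fst (l p) < x" "x < snd (l p)" "fst (l q) < x" "x < snd (l q)"
        using dense unfolding D_def by force
      then have "x \<in> {fst p<..<snd p} \<inter> {fst q<..<snd q}" by (auto simp: l_def)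
      then show False using dis \<open>p \<noteq> q\<close> by blast
    qed
    show "p = q" if "r p = r q" "r p \<in> D"
    proof (rule ccontr)
      assume "p \<noteq> q"
      from that obtain x where "fst (r p) < x" "x < snd (r p)" "fst (r q) < x" "x < snd (r q)"
        using dense unfolding D_def by force
      then have "x \<in> {fst p<..<snd p} \<inter> {fst q<..<snd q}" by (auto simp: r_def)
      then show False using dis \<open>p \<noteq> q\<close> by blast
    qed
  qed
  have red: "(\<Sum>p\<in>I. d (fst (g p)) (snd (g p))) = total (g ` I \<inter> D)"
    if "\<And>p q. p \<in> I \<Longrightarrow> q \<in> I \<Longrightarrow> g p = g q \<Longrightarrow> g p \<in> D \<Longrightarrow> p = q"
       "\<And>p. p \<in> I \<Longrightarrow> fst (g p) \<le> snd (g p)" for g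
  proof -
    have "(\<Sum>p\<in>I. d (fst (g p)) (snd (g p))) = (\<Sum>p\<in>{p\<in>I. g p \<in> D}. d (fst (g p)) (snd (g p)))"
    proof (intro sum.mono_neutral_right ballI)
      fix p assume "p \<in> I - {p \<in> I. g p \<in> D}"
      then have "fst (g p) = snd (g p)" using that(2)[of p] by (auto simp: D_def)
      then show "d (fst (g p)) (snd (g p)) = 0" by (simp add: refl0)
    qed (use fin in auto)
    also have "\<dots> = (\<Sum>p\<in>g ` {p\<in>I. g p \<in> D}. d (fst p) (snd p))"
      using that(1) by (subst sum.reindex) (auto simp: inj_on_def)
    also have "g ` {p\<in>I. g p \<in> D} = g ` I \<inter> D" by auto
    finally show ?thesis by (simp add: total_def case_prod_unfold)
  qed
  have le: "fst p < snd p" "a \<le> fst p" "snd p \<le> c" if "p \<in> I" for p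
    using I that by (auto simp: nonoverlapping_def)
  have step: "d (fst p) (snd p) \<le> d (fst (l p)) (snd (l p)) + d (fst (r p)) (snd (r p))"
    if "p \<in> I" for p
    using le[OF that] triangle[of "fst p" "snd p" b] nonneg
    by (auto simp: l_def r_def min_def max_def refl0)
  have "total I \<le> (\<Sum>p\<in>I. d (fst (l p)) (snd (l p)) + d (fst (r p)) (snd (r p)))"
    unfolding total_def case_prod_unfold by (intro sum_mono step)
  also have "\<dots> = total (l ` I \<inter> D) + total (r ` I \<inter> D)"
  proof -
    have "fst (l p) \<le> snd (l p)" "fst (r p) \<le> snd (r p)" if "p \<in> I" for p
      using le(1)[OF that] by (auto simp: l_def r_def)
    then have "(\<Sum>p\<in>I. d (fst (l p)) (snd (l p))) = total (l ` I \<inter> D)"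
      "(\<Sum>p\<in>I. d (fst (r p)) (snd (r p))) = total (r ` I \<inter> D)"
      using inj by (auto intro!: red)
    then show ?thesis by (simp add: sum.distrib)
  qed
  finally have tot: "total I \<le> total (l ` I \<inter> D) + total (r ` I \<inter> D)" .
  have dis: "{fst p<..<snd p} \<inter> {fst q<..<snd q} = {}" if "p \<in> I" "q \<in> I" "p \<noteq> q" for p q
    using I that by (auto simp: nonoverlapping_def)
  have "nonoverlapping a b (l ` I \<inter> D)"
    unfolding nonoverlapping_def
  proof (intro conjI ballI impI)
    show "case i of (u, v) \<Rightarrow> a \<le> u \<and> u < v \<and> v \<le> b" if "i \<in> l ` I \<inter> D" for i
      proof -
      from that obtain p where "p \<in> I" "i = l p" and "i \<in> D" by auto
      then show ?thesis using le[of p] by (auto simp: l_def D_def)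
    qed
    show "{fst i<..<snd i} \<inter> {fst j<..<snd j} = {}"
      if "i \<in> l ` I \<inter> D" "j \<in> l ` I \<inter> D" "i \<noteq> j" for i j
    proof -
      from that obtain p q where pq: "p \<in> I" "q \<in> I" "i = l p" "j = l q" by auto
      have "{fst i<..<snd i} \<subseteq> {fst p<..<snd p}" "{fst j<..<snd j} \<subseteq> {fst q<..<snd q}"
        using pq by (auto simp: l_def)
      then show ?thesis using dis[of p q] \<open>i \<noteq> j\<close> pq by blast
    qed
  qed (use fin in auto)
  moreover have "nonoverlapping b c (r ` I \<inter> D)"
    unfolding nonoverlapping_def
  proof (intro conjI ballI impI)
    show "case i of (u, v) \<Rightarrow> b \<le> u \<and> u < v \<and> v \<le> c" if "i \<in> r ` I \<inter> D" for i
      proof -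
      from that obtain p where "p \<in> I" "i = r p" and "i \<in> D" by auto
      then show ?thesis using le[of p] by (auto simp: r_def D_def)
    qed
    show "{fst i<..<snd i} \<inter> {fst j<..<snd j} = {}"
      if "i \<in> r ` I \<inter> D" "j \<in> r ` I \<inter> D" "i \<noteq> j" for i j
    proof -
      from that obtain p q where pq: "p \<in> I" "q \<in> I" "i = r p" "j = r q" by auto
      have "{fst i<..<snd i} \<subseteq> {fst p<..<snd p}" "{fst j<..<snd j} \<subseteq> {fst q<..<snd q}"
        using pq by (auto simp: r_def)
      then show ?thesis using dis[of p q] \<open>i \<noteq> j\<close> pq by blast
    qed
  qed (use fin in auto)
  ultimately show thesis using tot that by blast
qed

lemma family_empty: "nonoverlapping a b I \<Longrightarrow> b \<le> a \<Longrightarrow> I = {}"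
  by (fastforce simp: nonoverlapping_def)

text \<open>Families of total length below the \<open>\<delta>\<close> for \<open>\<epsilon> = 1\<close> have total at most 1, and \<open>[0, T]\<close> is covered
  by finitely many intervals of length \<open>\<delta> / 2\<close>.\<close>

lemma total_bounded:
  obtains B where "\<And>I. nonoverlapping 0 T I \<Longrightarrow> total I \<le> B"
proof -
  obtain \<delta> where \<delta>: "\<delta> > 0"
    "\<And>I. nonoverlapping 0 T I \<Longrightarrow> (\<Sum>(u, v)\<in>I. v - u) < \<delta> \<Longrightarrow> total I < 1"
    using ac unfolding ac_distance_def total_def by (metis zero_less_one)
  have "total I \<le> real n" if "nonoverlapping 0 b I" "b \<le> T" "b \<le> real n * (\<delta> / 2)" for n b I
    using that
  proof (induction n arbitrary: b I)
    case 0
    then show ?case using family_empty[of 0 b I] by (simp add: total_def)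
  next
    case (Suc n)
    \<comment> \<open>a family in \<open>[b', b]\<close> is short enough to have total below 1\<close>
    define b' where "b' = max 0 (b - \<delta> / 2)"
    show ?case
    proof (cases "b \<le> 0")
      case True
      then show ?thesis using family_empty[of 0 b I] Suc.prems by (simp add: total_def)
    next
      case False
      obtain I1 I2 where I: "nonoverlapping 0 b' I1" "nonoverlapping b' b I2"
        "total I \<le> total I1 + total I2"
        using split_family[OF Suc.prems(1)] by blast
      have b': "0 \<le> b'" "b' \<le> b" "b - b' < \<delta>" "b' \<le> real n * (\<delta> / 2)"
        using False \<delta>(1) Suc.prems(3) mult_nonneg_nonneg[of "real n" "\<delta> / 2"]
        by (auto simp: b'_def max_def algebra_simps)
      have "total I1 \<le> real n"
        using Suc.IH[OF I(1)] b' Suc.prems by linarith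
      moreover have "(\<Sum>(u, v)\<in>I2. v - u) \<le> measure lebesgue {b'..b}"
        using I(2) by (intro nonoverlapping_length[OF I(2)]) (fastforce simp: nonoverlapping_def)+
      then have "total I2 < 1"
        using b' Suc.prems(2) I(2) by (intro \<delta>(2)) (auto intro: nonoverlapping_mono)
      ultimately show ?thesis using I(3) by simp
    qed
  qed
  moreover obtain n where "T < real n * (\<delta> / 2)"
    using \<delta>(1) ex_less_of_nat_mult[of "\<delta> / 2" T] by auto
  ultimately show thesis using that[of "real n"] by fastforce
qed

lemma total_le_variation:
  assumes "nonoverlapping a b I" "0 \<le> a" "b \<le> T"
  shows "total I \<le> variation a b"
proof -
  obtain B where "\<And>I. nonoverlapping 0 T I \<Longrightarrow> total I \<le> B" using total_bounded by blast
  then have "bdd_above (total ` Collect (nonoverlapping a b))"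
    using assms(2,3) by (intro bdd_aboveI[of _ B]) (auto intro: nonoverlapping_mono)
  then show ?thesis
    unfolding variation_def using assms(1) by (intro cSup_upper) auto
qed

lemma variation_approx:
  assumes "e > 0"
  obtains I where "nonoverlapping a b I" "variation a b - e < total I"
proof -
  have "total {} \<in> total ` Collect (nonoverlapping a b)"
    by (intro imageI) (simp add: nonoverlapping_def)
  then have ne: "total ` Collect (nonoverlapping a b) \<noteq> {}" by blast
  have "variation a b - e < Sup (total ` Collect (nonoverlapping a b))"
    using assms by (simp add: variation_def)
  from less_cSupE[OF this ne]
  obtain y where "y \<in> total ` Collect (nonoverlapping a b)" "variation a b - e < y" .
  then show thesis using that by auto
qed

lemma variation_ge: "0 \<le> u \<Longrightarrow> u \<le> v \<Longrightarrow> v \<le> T \<Longrightarrow> d u v \<le> variation u v"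
proof (cases "u = v")
  case True
  assume "0 \<le> u" "v \<le> T"
  then show ?thesis
    using total_le_variation[of u v "{}"] True by (simp add: refl0 total_def nonoverlapping_def)
next
  case False
  assume "0 \<le> u" "u \<le> v" "v \<le> T"
  then show ?thesis
    using total_le_variation[of u v "{(u, v)}"] False nonoverlapping_single[of u u v v]
    by (simp add: total_def)
qed

text \<open>Additivity makes the variation of \<open>[u, v]\<close> an increment of the monotone function
  \<open>t \<mapsto> variation 0 t\<close>, which dominates \<open>d u v\<close>.\<close>

lemma variation_add:
  assumes "0 \<le> a" "a \<le> b" "b \<le> c" "c \<le> T"
  shows "variation a c = variation a b + variation b c"
proof (rule antisym; rule field_le_epsilon)
  fix e :: real assume "e > 0"
  then obtain I where I: "nonoverlapping a c I" "variation a c - e < total I"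
    using variation_approx by blast
  obtain I1 I2 where "nonoverlapping a b I1" "nonoverlapping b c I2" "total I \<le> total I1 + total I2"
    using split_family[OF I(1)] by blast
  then show "variation a c \<le> variation a b + variation b c + e"
    using I(2) assms total_le_variation[of a b I1] total_le_variation[of b c I2] by linarith
next
  fix e :: real assume "e > 0"
  then have "e / 2 > 0" by simp
  obtain I where I: "nonoverlapping a b I" "variation a b - e / 2 < total I"
    using variation_approx[OF \<open>e / 2 > 0\<close>] by blast
  obtain J where J: "nonoverlapping b c J" "variation b c - e / 2 < total J"
    using variation_approx[OF \<open>e / 2 > 0\<close>] by blast
  have IJ: "fst p < snd p" "snd p \<le> b" "a \<le> fst p" "fst q < snd q" "b \<le> fst q" "snd q \<le> c"
    if "p \<in> I" "q \<in> J" for p q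
    using I(1) J(1) that by (auto simp: nonoverlapping_def)
  have "{fst p<..<snd p} \<inter> {fst q<..<snd q} = {}" if "p \<in> I" "q \<in> J" for p q
    using IJ[OF that] by auto
  then have "nonoverlapping a c (I \<union> J)"
    using I(1) J(1) assms unfolding nonoverlapping_def by (auto simp: Int_commute) force+
  then have "total (I \<union> J) \<le> variation a c"
    using assms total_le_variation by auto
  moreover have "I \<inter> J = {}" using IJ by fastforce
  then have "total (I \<union> J) = total I + total J"
    using I(1) J(1) unfolding total_def nonoverlapping_def by (intro sum.union_disjoint) auto
  ultimately show "variation a b + variation b c \<le> variation a c + e"
    using I(2) J(2) by linarith
qed

lemma variation_increment:
  "0 \<le> u \<Longrightarrow> u \<le> v \<Longrightarrow> v \<le> T \<Longrightarrow> variation 0 v - variation 0 u = variation u v"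
  using variation_add[of 0 u v] by simp

text \<open>Almost optimal families inside the intervals of a given short family form together another short
  family, to which the absolute continuity of \<open>d\<close> applies.\<close>

lemma variation_ac: "ac_distance T (\<lambda>u v. variation 0 v - variation 0 u)"
  unfolding ac_distance_def
proof (intro allI impI)
  fix e :: real assume "e > 0"
  then obtain \<delta> where \<delta>: "\<delta> > 0"
    "\<And>I. nonoverlapping 0 T I \<Longrightarrow> (\<Sum>(u, v)\<in>I. v - u) < \<delta> \<Longrightarrow> total I < e / 2"
    using ac unfolding ac_distance_def total_def by (meson half_gt_zero)
  show "\<exists>\<delta>>0. \<forall>I. nonoverlapping 0 T I \<and> (\<Sum>(u, v)\<in>I. v - u) < \<delta> \<longrightarrow>
      (\<Sum>(u, v)\<in>I. variation 0 v - variation 0 u) < e"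
  proof (intro exI[of _ \<delta>] conjI allI impI)
    fix J assume J: "nonoverlapping 0 T J \<and> (\<Sum>(u, v)\<in>J. v - u) < \<delta>"
    define n where "n = real (card J) + 1"
    have fin: "finite J" and JD: "\<And>u v. (u, v) \<in> J \<Longrightarrow> 0 \<le> u \<and> u < v \<and> v \<le> T"
      using J by (auto simp: nonoverlapping_def)
    \<comment> \<open>each inner family may lose \<open>e / (2 n)\<close>, in total at most half of \<open>e\<close>\<close>
    have "e / (2 * n) > 0" using \<open>e > 0\<close> by (simp add: n_def)
    then have "\<exists>I. nonoverlapping (fst j) (snd j) I \<and>
        variation (fst j) (snd j) - e / (2 * n) < total I" for j
      by (rule variation_approx[where a = "fst j" and b = "snd j"]) blast
    then have "\<exists>K. \<forall>j. nonoverlapping (fst j) (snd j) (K j) \<and>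
        variation (fst j) (snd j) - e / (2 * n) < total (K j)"
      by (intro choice allI)
    then obtain K where K: "\<And>j. nonoverlapping (fst j) (snd j) (K j)"
      "\<And>j. variation (fst j) (snd j) - e / (2 * n) < total (K j)" by blast
    define U where "U = (\<Union>j\<in>J. K j)"
    have "nonoverlapping u v (K (u, v))" for u v
      using K(1)[of "(u, v)"] by simp
    note UN = nonoverlapping_UN[of 0 T J K, OF conjunct1[OF J] this]
    have U: "nonoverlapping 0 T U" "\<And>i j. i \<in> J \<Longrightarrow> j \<in> J \<Longrightarrow> i \<noteq> j \<Longrightarrow> K i \<inter> K j = {}"
      unfolding U_def using UN by blast+
    have finK: "finite (K j)" for j using K(1)[of j] by (simp add: nonoverlapping_def)
    have sumU: "(\<Sum>p\<in>U. g p) = (\<Sum>j\<in>J. \<Sum>p\<in>K j. g p)" for g :: "real \<times> real \<Rightarrow> real"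
      unfolding U_def using fin finK U(2) by (intro sum.UNION_disjoint) auto
    have "(\<Sum>(u, v)\<in>K j. v - u) \<le> snd j - fst j" if "j \<in> J" for j
    proof -
      have "(\<Sum>(u, v)\<in>K j. v - u) \<le> measure lebesgue {fst j..snd j}"
        using K(1)[of j] by (intro nonoverlapping_length) (fastforce simp: nonoverlapping_def)+
      then show ?thesis using JD[of "fst j" "snd j"] that by simp
    qed
    then have "(\<Sum>(u, v)\<in>U. v - u) \<le> (\<Sum>(u, v)\<in>J. v - u)"
      unfolding sumU by (intro sum_mono) (auto simp: case_prod_unfold)
    then have "total U < e / 2"
      using J U(1) by (intro \<delta>(2)) auto
    moreover have "total U = (\<Sum>j\<in>J. total (K j))"
      unfolding total_def sumU ..
    moreover have "(\<Sum>j\<in>J. variation (fst j) (snd j)) \<le> (\<Sum>j\<in>J. total (K j) + e / (2 * n))"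
      using K(2) by (intro sum_mono) (smt (verit))
    moreover have "(\<Sum>j\<in>J. e / (2 * n)) \<le> e / 2"
      using \<open>e > 0\<close> by (simp add: n_def field_simps)
    moreover have "(\<Sum>(u, v)\<in>J. variation 0 v - variation 0 u) = (\<Sum>j\<in>J. variation (fst j) (snd j))"
      using JD by (intro sum.cong) (auto simp: variation_increment less_imp_le)
    ultimately show "(\<Sum>(u, v)\<in>J. variation 0 v - variation 0 u) < e"
      unfolding sum.distrib by linarith
  qed (rule \<delta>(1))
qed

end

section \<open>Densities of absolutely continuous functions\<close>

lemma ac_distance_continuous_on:
  fixes F :: "real \<Rightarrow> real"
  assumes ac: "ac_distance T d" and le: "\<And>u v. 0 \<le> u \<Longrightarrow> u < v \<Longrightarrow> v \<le> T \<Longrightarrow> \<bar>F v - F u\<bar> \<le> d u v"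
  shows "continuous_on {0..T} F"
  unfolding continuous_on_iff
proof (intro ballI allI impI)
  fix x e :: real assume x: "x \<in> {0..T}" and "e > 0"
  then obtain \<delta> where \<delta>: "\<delta> > 0"
    "\<And>I. nonoverlapping 0 T I \<Longrightarrow> (\<Sum>(u, v)\<in>I. v - u) < \<delta> \<Longrightarrow> (\<Sum>(u, v)\<in>I. d u v) < e"
    using ac unfolding ac_distance_def by blast
  have *: "\<bar>F v - F u\<bar> < e" if "0 \<le> u" "u < v" "v \<le> T" "v - u < \<delta>" for u v
    using \<delta>(2)[OF nonoverlapping_single[of 0 u v T]] le[of u v] that by simp
  have "dist (F y) (F x) < e" if "y \<in> {0..T}" "dist y x < \<delta>" for y
    using *[of x y] *[of y x] that x \<open>e > 0\<close>
    by (cases x y rule: linorder_cases) (simp_all add: dist_real_def abs_minus_commute)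
  then show "\<exists>d>0. \<forall>y\<in>{0..T}. dist y x < d \<longrightarrow> dist (F y) (F x) < e"
    using \<delta>(1) by blast
qed

text \<open>The Stieltjes measure of a monotone absolutely continuous function vanishes on Lebesgue null sets:
  such a set is covered by countably many nonoverlapping intervals of small total length, on which
  the measure is the sum of the increments. Its Radon-Nikodym density is the required function.\<close>

lemma monotone_ac_density:
  fixes G :: "real \<Rightarrow> real"
  assumes T: "T > 0" and mono_G: "mono_on {0..T} G"
    and ac: "ac_distance T (\<lambda>u v. G v - G u)"
  shows "\<exists>g. g \<in> borel_measurable borel \<and> (\<forall>t. 0 \<le> g t) \<and> integrable lborel g \<and>
    (\<forall>a b. 0 \<le> a \<longrightarrow> a \<le> b \<longrightarrow> b \<le> T \<longrightarrow> G b - G a = (LBINT t:{a..b}. g t))"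
proof -
  have mono: "0 \<le> u \<Longrightarrow> u \<le> v \<Longrightarrow> v \<le> T \<Longrightarrow> G u \<le> G v" for u v
    using mono_G by (simp add: mono_on_def)
  define cl where "cl t = max 0 (min T t)" for t
  define H where "H t = G (cl t)" for t
  have cl: "0 \<le> cl t" "cl t \<le> T" "u \<le> v \<Longrightarrow> cl u \<le> cl v" for t u v
    using T by (auto simp: cl_def max_def min_def)
  have H_mono: "u \<le> v \<Longrightarrow> H u \<le> H v" for u v
    unfolding H_def by (intro mono cl)
  have H_in: "0 \<le> t \<Longrightarrow> t \<le> T \<Longrightarrow> H t = G t" for t
    by (simp add: H_def cl_def)
  have H_cont: "continuous_on UNIV H"
  proof -
    have "continuous_on {0..T} G"
      by (rule ac_distance_continuous_on[OF ac]) (use mono in simp)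
    moreover have "continuous_on UNIV cl" unfolding cl_def by (intro continuous_intros)
    ultimately show ?thesis
      unfolding H_def by (rule continuous_on_compose2) (use cl in auto)
  qed
  define \<nu> where "\<nu> = interval_measure H"
  have right_cont: "continuous (at_right a) H" for a
    using H_cont by (auto simp: continuous_on_eq_continuous_within intro: continuous_within_subset)
  have Ioc: "a \<le> b \<Longrightarrow> emeasure \<nu> {a<..b} = ennreal (H b - H a)" for a b
    unfolding \<nu>_def by (intro emeasure_interval_measure_Ioc H_mono right_cont)
  have Icc: "a \<le> b \<Longrightarrow> emeasure \<nu> {a..b} = ennreal (H b - H a)" for a b
    unfolding \<nu>_def by (intro emeasure_interval_measure_Icc H_mono H_cont)
  have sets_\<nu>[measurable_cong, simp]: "sets \<nu> = sets borel" by (simp add: \<nu>_def)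

  \<comment> \<open>the clamped function is constant outside \<open>[0, T]\<close>\<close>
  have outside: "- {0..T} \<in> null_sets \<nu>"
  proof -
    have "(\<Union>k::nat. {- real k<..0} \<union> {T<..T + real k}) \<in> null_sets \<nu>"
      using T by (intro null_sets_UN null_sets.Un)
        (auto simp: null_sets_def Ioc H_def cl_def max_def min_def)
    moreover have "- {0..T} \<subseteq> (\<Union>k::nat. {- real k<..0} \<union> {T<..T + real k})"
    proof
      fix x assume "x \<in> - {0..T}"
      moreover obtain k :: nat where "\<bar>x\<bar> + T < real k" using reals_Archimedean2 by blast
      ultimately show "x \<in> (\<Union>k::nat. {- real k<..0} \<union> {T<..T + real k})"
        using T by (intro UN_I[of k]) auto
    qed
    ultimately show ?thesis by (intro null_sets_subset[where A = "- {0..T}"]) auto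
  qed

  have inside: "emeasure \<nu> (N \<inter> {0..T}) \<le> 0" if N: "N \<in> null_sets lborel" for N
  proof (rule ennreal_le_epsilon)
    fix e :: real assume "e > 0"
    then obtain \<delta> where \<delta>: "\<delta> > 0"
      "\<And>I. nonoverlapping 0 T I \<Longrightarrow> (\<Sum>(u, v)\<in>I. v - u) < \<delta> \<Longrightarrow> (\<Sum>(u, v)\<in>I. G v - G u) < e"
      using ac unfolding ac_distance_def by blast
    define S where "S = N \<inter> {0..T}"
    have "S \<in> null_sets lborel"
      unfolding S_def using N by (intro null_set_Int2) auto
    then have S0: "S \<in> null_sets lebesgue" by (rule null_sets_completionI)
    then have S: "S \<in> lmeasurable" "measure lebesgue S = 0" "S \<subseteq> cbox 0 T"
      by (auto simp: S_def fmeasurableI_null_sets measure_eq_0_null_sets)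
    obtain D where D: "countable D" "\<And>K. K \<in> D \<Longrightarrow> K \<subseteq> cbox 0 T \<and> K \<noteq> {} \<and> (\<exists>c d. K = cbox c d)"
      "pairwise (\<lambda>A B. interior A \<inter> interior B = {}) D"
      "\<And>K. K \<in> D \<Longrightarrow> interior K \<noteq> {}"
      "S \<subseteq> \<Union>D" "\<Union>D \<in> lmeasurable" "measure lebesgue (\<Union>D) \<le> measure lebesgue S + \<delta> / 2"
    proof (rule measurable_outer_intervals_bounded[OF S(1,3), of "\<delta> / 2"], goal_cases)
      case (2 D)
      show ?case using T by (intro 2(1)[of D]) (use 2(2-) in auto)
    qed (use \<delta>(1) in auto)
    have KD: "K = {Inf K..Sup K} \<and> Inf K < Sup K \<and> 0 \<le> Inf K \<and> Sup K \<le> T" if "K \<in> D" for K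
    proof -
      obtain c d where K: "K = {c..d}" using D(2)[OF \<open>K \<in> D\<close>] by auto
      moreover have "c < d" using D(4)[OF \<open>K \<in> D\<close>] K by (simp add: interior_atLeastAtMost_real)
      ultimately show ?thesis using D(2)[OF \<open>K \<in> D\<close>] by auto
    qed
    have D_borel: "K \<in> sets borel" if "K \<in> D" for K
      using D(2)[OF that] by auto
    have fin: "emeasure \<nu> (\<Union>D') \<le> ennreal e" if D': "D' \<subseteq> D" "finite D'" for D'
    proof -
      define I where "I = (\<lambda>K. (Inf K, Sup K)) ` D'"
      have inj: "inj_on (\<lambda>K. (Inf K, Sup K)) D'"
        using KD D'(1) by (intro inj_onI) (metis prod.inject subsetD)
      have int: "interior K = {Inf K<..<Sup K}" if "K \<in> D" for K
        using KD[OF that] interior_atLeastAtMost_real by metis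
      have I: "nonoverlapping 0 T I"
        unfolding nonoverlapping_def
      proof (intro conjI ballI impI)
        show "{fst i<..<snd i} \<inter> {fst j<..<snd j} = {}" if ij: "i \<in> I" "j \<in> I" "i \<noteq> j" for i j
        proof -
          obtain A B where AB: "A \<in> D'" "B \<in> D'" "i = (Inf A, Sup A)" "j = (Inf B, Sup B)"
            using ij by (auto simp: I_def)
          then have "A \<noteq> B" "A \<in> D" "B \<in> D" using ij(3) D'(1) by auto
          then have "interior A \<inter> interior B = {}"
            using pairwiseD[OF D(3)] by blast
          then show ?thesis
            by (simp only: AB(3,4) fst_conv snd_conv int[OF \<open>A \<in> D\<close>] int[OF \<open>B \<in> D\<close>])
        qed
      qed (use D' KD in \<open>auto simp: I_def\<close>)
      have "(\<Sum>(u, v)\<in>I. v - u) \<le> measure lebesgue (\<Union>D)"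
      proof (rule nonoverlapping_length[OF I D(6)])
        fix u v assume "(u, v) \<in> I"
        then obtain K where "K \<in> D" "u = Inf K" "v = Sup K" using D'(1) by (auto simp: I_def)
        then show "{u<..<v} \<subseteq> \<Union>D" using KD[of K] by fastforce
      qed
      also have "\<dots> < \<delta>" using D(7) S(2) \<delta>(1) by simp
      finally have small: "(\<Sum>(u, v)\<in>I. G v - G u) < e" by (rule \<delta>(2)[OF I])
      have "emeasure \<nu> (\<Union>D') \<le> (\<Sum>K\<in>D'. emeasure \<nu> K)"
        using emeasure_subadditive_finite[of D' "\<lambda>K. K" \<nu>] D' D_borel by auto
      also have "\<dots> = (\<Sum>K\<in>D'. ennreal (G (Sup K) - G (Inf K)))"
      proof (rule sum.cong)
        fix K assume "K \<in> D'"
        then have K: "K = {Inf K..Sup K} \<and> Inf K < Sup K \<and> 0 \<le> Inf K \<and> Sup K \<le> T"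
          using KD D'(1) by blast
        then have "emeasure \<nu> {Inf K..Sup K} = ennreal (G (Sup K) - G (Inf K))"
          by (subst Icc) (auto simp: H_in)
        then show "emeasure \<nu> K = ennreal (G (Sup K) - G (Inf K))" using K by simp
      qed simp
      also have "\<dots> = ennreal (\<Sum>K\<in>D'. G (Sup K) - G (Inf K))"
      proof (rule sum_ennreal)
        fix K assume "K \<in> D'"
        then show "0 \<le> G (Sup K) - G (Inf K)" using KD[of K] D'(1) mono[of "Inf K" "Sup K"] by auto
      qed
      also have "(\<Sum>K\<in>D'. G (Sup K) - G (Inf K)) = (\<Sum>(u, v)\<in>I. G v - G u)"
        unfolding I_def by (subst sum.reindex[OF inj]) auto
      also have "ennreal \<dots> \<le> ennreal e" using small by (intro ennreal_leI) simp
      finally show ?thesis .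
    qed
    have "emeasure \<nu> (\<Union>D) \<le> ennreal e"
    proof (cases "D = {}")
      case False
      define A where "A n = \<Union>(from_nat_into D ` {..n})" for n :: nat
      have mem: "from_nat_into D n \<in> D" for n using from_nat_into[OF False] .
      have "\<Union>D = (\<Union>n. A n)"
      proof (intro equalityI subsetI)
        fix x assume "x \<in> \<Union>D"
        then obtain K where K: "K \<in> D" "x \<in> K" by blast
        then obtain n where "from_nat_into D n = K" using from_nat_into_surj[OF D(1)] by blast
        then show "x \<in> (\<Union>n. A n)" using K by (auto simp: A_def)
      qed (use mem in \<open>auto simp: A_def\<close>)
      moreover have "range A \<subseteq> sets \<nu>"
        unfolding A_def using mem D_borel by auto
      moreover have "incseq A" unfolding A_def incseq_def by fastforce
      ultimately have "emeasure \<nu> (\<Union>D) = (SUP n. emeasure \<nu> (A n))"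
        by (simp add: SUP_emeasure_incseq)
      also have "\<dots> \<le> ennreal e"
        unfolding A_def using mem by (intro SUP_least fin) auto
      finally show ?thesis .
    qed simp
    moreover have "emeasure \<nu> S \<le> emeasure \<nu> (\<Union>D)"
    proof (rule emeasure_mono[OF D(5)])
      show "\<Union>D \<in> sets \<nu>"
        using D(1) D_borel by (intro sets.countable_Union) auto
    qed
    ultimately show "emeasure \<nu> (N \<inter> {0..T}) \<le> 0 + ennreal e" unfolding S_def by simp
  qed

  have "absolutely_continuous lborel \<nu>"
    unfolding absolutely_continuous_def
  proof
    fix N :: "real set" assume N: "N \<in> null_sets lborel"
    then have "N \<inter> {0..T} \<in> null_sets \<nu>" using inside by (auto simp: null_sets_def)
    from null_sets.Un[OF this outside] have "N \<inter> {0..T} \<union> - {0..T} \<in> null_sets \<nu>" .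
    then show "N \<in> null_sets \<nu>"
      by (intro null_sets_subset[where A = N]) (use N in \<open>auto simp: null_sets_def\<close>)
  qed
  then obtain f where f: "f \<in> borel_measurable lborel" "density lborel f = \<nu>"
    using sigma_finite_measure.Radon_Nikodym[OF sigma_finite_lborel, of \<nu>] by auto
  have f_Icc: "(\<integral>\<^sup>+t. f t * indicator {a..b} t \<partial>lborel) = ennreal (G b - G a)"
    if "0 \<le> a" "a \<le> b" "b \<le> T" for a b
    using that f Icc[of a b] H_in emeasure_density[of f lborel "{a..b}"] by simp
  have "(\<integral>\<^sup>+t. f t * indicator {0..T} t \<partial>lborel) \<noteq> \<infinity>"
    using T by (simp add: f_Icc)
  then have fin: "AE t in lborel. f t * indicator {0..T} t \<noteq> \<infinity>"
    using f(1) by (intro nn_integral_noteq_infinite) auto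
  define g where "g t = enn2real (f t * indicator {0..T} t)" for t
  have g_meas: "g \<in> borel_measurable borel" using f(1) unfolding g_def by measurable
  have g_AE: "AE t in lborel. ennreal (g t) = f t * indicator {0..T} t"
    using fin by eventually_elim (simp add: g_def less_top)
  have g_Icc: "(\<integral>\<^sup>+t. ennreal (indicator {a..b} t * g t) \<partial>lborel) = ennreal (G b - G a)"
    if "0 \<le> a" "a \<le> b" "b \<le> T" for a b
  proof -
    have "(\<integral>\<^sup>+t. ennreal (indicator {a..b} t * g t) \<partial>lborel) = (\<integral>\<^sup>+t. f t * indicator {a..b} t \<partial>lborel)"
    proof (rule nn_integral_cong_AE)
      show "AE t in lborel. ennreal (indicator {a..b} t * g t) = f t * indicator {a..b} t"
        using g_AE by eventually_elim (use that in \<open>auto simp: indicator_def split: if_splits\<close>)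
    qed
    then show ?thesis using f_Icc that by simp
  qed
  have "G b - G a = (LBINT t:{a..b}. g t)" if "0 \<le> a" "a \<le> b" "b \<le> T" for a b
  proof -
    have "(\<lambda>t. indicator {a..b} t * g t) \<in> borel_measurable lborel" using g_meas by measurable
    moreover have "0 \<le> g t" for t by (simp add: g_def)
    ultimately show ?thesis
      unfolding set_lebesgue_integral_def real_scaleR_def
      using g_Icc[OF that] mono[OF that]
      by (subst integral_eq_nn_integral) auto
  qed
  moreover have "integrable lborel g"
  proof (rule integrableI_nonneg)
    have "(\<integral>\<^sup>+t. ennreal (g t) \<partial>lborel) = (\<integral>\<^sup>+t. ennreal (indicator {0..T} t * g t) \<partial>lborel)"
      by (intro nn_integral_cong) (auto simp: g_def indicator_def)
    then show "(\<integral>\<^sup>+t. ennreal (g t) \<partial>lborel) < \<infinity>"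
      using g_Icc[of 0 T] T by simp
  qed (use g_meas in \<open>auto simp: g_def\<close>)
  ultimately show ?thesis using g_meas by (intro exI[of _ g]) (simp add: g_def)
qed

lemma integrable_imp_set_integrable:
  fixes f :: "real \<Rightarrow> real"
  shows "integrable lborel f \<Longrightarrow> A \<in> sets borel \<Longrightarrow> set_integrable lborel A f"
  unfolding set_integrable_def by (intro integrable_mult_indicator) simp_all

lemma indefinite_integral_right_derivative:
  fixes f :: "real \<Rightarrow> real"
  assumes "integrable lborel f"
  shows "AE t in lborel. ((\<lambda>h. (LBINT s:{t..t + h}. f s) / h) \<longlongrightarrow> f t) (at_right 0)"
proof -
  have int: "set_integrable lborel {a..b} f" for a b
    using assms by (rule integrable_imp_set_integrable) simp
  then have "f integrable_on cbox a b" for a b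
    using set_borel_integral_eq_integral(1)[OF int] by simp
  then obtain N where N: "negligible N" "\<And>x e. x \<notin> N \<Longrightarrow> 0 < e \<Longrightarrow>
      \<exists>d>0. \<forall>h. 0 < h \<and> h < d \<longrightarrow>
        norm (integral (cbox x (x + h *\<^sub>R One)) f /\<^sub>R h ^ DIM(real) - f x) < e"
    using integrable_ccontinuous_explicit by blast
  have lim: "((\<lambda>h. (LBINT s:{t..t + h}. f s) / h) \<longlongrightarrow> f t) (at_right 0)" if tN: "t \<notin> N" for t
    unfolding tendsto_iff
  proof (intro allI impI)
    fix e :: real assume "e > 0"
    then obtain d where d: "d > 0" "\<And>h. 0 < h \<Longrightarrow> h < d \<Longrightarrow>
        norm (integral (cbox t (t + h *\<^sub>R One)) f /\<^sub>R h ^ DIM(real) - f t) < e"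
      using N(2)[OF tN] by blast
    have "dist ((LBINT s:{t..t + h}. f s) / h) (f t) < e" if "0 < h" "h < d" for h
      using d(2)[OF that] set_borel_integral_eq_integral(2)[OF int, of t "t + h"]
      by (simp add: dist_real_def divide_inverse_commute)
    then show "\<forall>\<^sub>F h in at_right 0. dist ((LBINT s:{t..t + h}. f s) / h) (f t) < e"
      unfolding eventually_at_right_field using d(1) by (intro exI[of _ d]) auto
  qed
  have "N \<in> null_sets lebesgue" using N(1) by (simp add: negligible_iff_null_sets)
  then have "AE t in lebesgue. t \<notin> N" by (rule AE_not_in)
  then have "AE t in lborel. t \<notin> N" by (simp add: AE_completion_iff)
  then show ?thesis by eventually_elim (rule lim)
qed

lemma AE_lborel_uminus:
  assumes "AE t in lborel. P (t :: real)"
  shows "AE t in lborel. P (- t)"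
proof -
  have "AE t in distr lborel borel uminus. P t"
    unfolding lborel_distr_uminus by (rule assms)
  then show ?thesis
    by (rule AE_distrD[rotated]) simp
qed

text \<open>Reflection at the origin exchanges left and right difference quotients.\<close>

lemma indefinite_integral_left_derivative:
  fixes f :: "real \<Rightarrow> real"
  assumes "integrable lborel f"
  shows "AE t in lborel. ((\<lambda>h. (LBINT s:{t - h..t}. f s) / h) \<longlongrightarrow> f t) (at_right 0)"
proof -
  have "integrable lborel (\<lambda>s. f (- s))"
    using lborel_integrable_real_affine[OF assms, of "-1" 0] by simp
  from AE_lborel_uminus[OF indefinite_integral_right_derivative[OF this]]
  have "AE t in lborel. ((\<lambda>h. (LBINT s:{- t..- t + h}. f (- s)) / h) \<longlongrightarrow> f t) (at_right 0)"
    by simp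
  moreover have "(LBINT s:{- t..- t + h}. f (- s)) = (LBINT s:{t - h..t}. f s)" for t h
    unfolding set_lebesgue_integral_def
    by (subst lborel_integral_real_affine[of "-1" _ 0])
       (auto simp: indicator_def intro!: Bochner_Integration.integral_cong)
  ultimately show ?thesis by simp
qed

text \<open>The integral over the interval between \<open>t\<close> and \<open>s\<close>, for \<open>s\<close> on either side of \<open>t\<close>, allows one
  statement for both signs of \<open>s - t\<close>.\<close>

lemma lebesgue_differentiation:
  fixes f :: "real \<Rightarrow> real"
  assumes f: "integrable lborel f"
  shows "AE t in lborel. ((\<lambda>s. (LBINT r:{min s t..max s t}. f r) / \<bar>s - t\<bar>) \<longlongrightarrow> f t) (at t)"
  using indefinite_integral_right_derivative[OF f] indefinite_integral_left_derivative[OF f]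
proof eventually_elim
  case (elim t)
  have "((\<lambda>s. (LBINT r:{min s t..max s t}. f r) / \<bar>s - t\<bar>) \<longlongrightarrow> f t) (at_right t)"
    unfolding filterlim_at_right_to_0[of _ _ t]
    by (rule Lim_transform_eventually[OF elim(1)])
       (auto simp: eventually_at_right_field add.commute intro!: exI[of _ 1])
  moreover have "((\<lambda>s. (LBINT r:{min s t..max s t}. f r) / \<bar>s - t\<bar>) \<longlongrightarrow> f t) (at_left t)"
    unfolding filterlim_at_left_to_right filterlim_at_right_to_0[of _ _ "- t"]
    by (rule Lim_transform_eventually[OF elim(2)])
       (auto simp: eventually_at_right_field add.commute intro!: exI[of _ 1])
  ultimately show ?case by (simp add: filterlim_split_at)
qed

text \<open>With \<open>V\<close> the variation of \<open>F\<close>, both \<open>V\<close> and \<open>V + F\<close> are monotone and absolutely continuous; the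
  difference of their densities is a density of \<open>F\<close>, and Lebesgue differentiation turns it into the
  derivative.\<close>

theorem ac_function_density:
  fixes F :: "real \<Rightarrow> real"
  assumes T: "T > 0" and ac: "ac_distance T (\<lambda>u v. \<bar>F v - F u\<bar>)"
  obtains f where "f \<in> borel_measurable borel" "integrable lborel f"
    "\<And>a b. 0 \<le> a \<Longrightarrow> a \<le> b \<Longrightarrow> b \<le> T \<Longrightarrow> F b - F a = (LBINT t:{a..b}. f t)"
    "AE t in lborel. t \<in> {0..T} \<longrightarrow> (F has_real_derivative f t) (at t within {0..T})"
proof -
  interpret ac_pseudometric T "\<lambda>u v. \<bar>F v - F u\<bar>"
    using ac by unfold_locales auto
  define V where "V = variation 0"
  have V: "\<bar>F v - F u\<bar> \<le> V v - V u" if "0 \<le> u" "u \<le> v" "v \<le> T" for u v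
    using that variation_ge variation_increment by (simp add: V_def)
  have V_mono: "mono_on {0..T} V"
    using V by (fastforce intro!: mono_onI)
  have ac_V: "ac_distance T (\<lambda>u v. V v - V u)" unfolding V_def by (rule variation_ac)
  obtain g where g: "g \<in> borel_measurable borel" "\<And>t. 0 \<le> g t" "integrable lborel g"
    "\<And>a b. 0 \<le> a \<Longrightarrow> a \<le> b \<Longrightarrow> b \<le> T \<Longrightarrow> V b - V a = (LBINT t:{a..b}. g t)"
    using monotone_ac_density[OF T V_mono ac_V] by auto
  have ac_VF: "ac_distance T (\<lambda>u v. (V v + F v) - (V u + F u))"
    unfolding ac_distance_def
  proof (intro allI impI)
    fix e :: real assume "e > 0"
    then have "e / 2 > 0" by simp
    then obtain \<delta> where \<delta>: "\<delta> > 0"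
      "\<And>I. nonoverlapping 0 T I \<Longrightarrow> (\<Sum>(u, v)\<in>I. v - u) < \<delta> \<Longrightarrow> (\<Sum>(u, v)\<in>I. V v - V u) < e / 2"
      using ac_V unfolding ac_distance_def by blast
    have "(\<Sum>(u, v)\<in>I. (V v + F v) - (V u + F u)) < e"
      if I: "nonoverlapping 0 T I" "(\<Sum>(u, v)\<in>I. v - u) < \<delta>" for I
    proof -
      have "(V v + F v) - (V u + F u) \<le> (V v - V u) + (V v - V u)" if "(u, v) \<in> I" for u v
        using V[of u v] that I(1) by (fastforce simp: nonoverlapping_def)
      then have "(\<Sum>(u, v)\<in>I. (V v + F v) - (V u + F u)) \<le> (\<Sum>(u, v)\<in>I. (V v - V u) + (V v - V u))"
        by (intro sum_mono) (simp add: case_prod_unfold)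
      also have "\<dots> = (\<Sum>(u, v)\<in>I. V v - V u) + (\<Sum>(u, v)\<in>I. V v - V u)"
        by (simp only: case_prod_unfold sum.distrib)
      finally show ?thesis using \<delta>(2)[OF I] by linarith
    qed
    then show "\<exists>\<delta>>0. \<forall>I. nonoverlapping 0 T I \<and> (\<Sum>(u, v)\<in>I. v - u) < \<delta> \<longrightarrow>
        (\<Sum>(u, v)\<in>I. (V v + F v) - (V u + F u)) < e"
      using \<delta>(1) by blast
  qed
  have VF_mono: "mono_on {0..T} (\<lambda>t. V t + F t)"
    using V by (fastforce intro!: mono_onI simp: abs_le_iff)
  obtain h where h: "h \<in> borel_measurable borel" "\<And>t. 0 \<le> h t" "integrable lborel h"
    "\<And>a b. 0 \<le> a \<Longrightarrow> a \<le> b \<Longrightarrow> b \<le> T \<Longrightarrow> (V b + F b) - (V a + F a) = (LBINT t:{a..b}. h t)"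
    using monotone_ac_density[OF T VF_mono ac_VF] by auto
  define f where "f t = h t - g t" for t
  have f: "f \<in> borel_measurable borel" "integrable lborel f"
    using g h unfolding f_def by auto
  have FTC: "F b - F a = (LBINT t:{a..b}. f t)" if "0 \<le> a" "a \<le> b" "b \<le> T" for a b
  proof -
    have "(LBINT t:{a..b}. f t) = (LBINT t:{a..b}. h t) - (LBINT t:{a..b}. g t)"
      unfolding f_def using g(3) h(3)
      by (intro set_integral_diff integrable_imp_set_integrable) simp_all
    then show ?thesis using g(4)[OF that] h(4)[OF that] by simp
  qed
  have deriv: "AE t in lborel. t \<in> {0..T} \<longrightarrow> (F has_real_derivative f t) (at t within {0..T})"
    using lebesgue_differentiation[OF f(2)]
  proof eventually_elim
    case (elim t)
    show ?case
    proof
      assume t: "t \<in> {0..T}"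
      have "((\<lambda>s. (F s - F t) / (s - t)) \<longlongrightarrow> f t) (at t within {0..T})"
      proof (rule Lim_transform_eventually[OF tendsto_within_subset[OF elim]])
        have "(LBINT r:{min s t..max s t}. f r) / \<bar>s - t\<bar> = (F s - F t) / (s - t)"
          if "s \<in> {0..T}" "s \<noteq> t" for s
          using that t FTC[of s t] FTC[of t s]
          by (cases "s < t") (auto simp: field_simps)
        then show "\<forall>\<^sub>F s in at t within {0..T}.
            (LBINT r:{min s t..max s t}. f r) / \<bar>s - t\<bar> = (F s - F t) / (s - t)"
          by (auto simp: eventually_at_filter)
      qed simp
      then show "(F has_real_derivative f t) (at t within {0..T})"
        by (simp add: has_field_derivative_iff)
    qed
  qed
  show thesis by (rule that[OF f _ deriv]) (rule FTC)
qed

section \<open>The norm of summable families\<close>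

lemma abs_summable_iff: "(\<lambda>x. \<bar>v x :: real\<bar>) summable_on A \<longleftrightarrow> v summable_on A"
  using summable_on_iff_abs_summable_on_real[of v A] by simp

lemma has_sum_minusI: "(f has_sum a) A \<Longrightarrow> ((\<lambda>x. - f x :: real) has_sum - a) A"
  by (simp add: has_sum_uminus)

lemma infsum_diff_real:
  fixes f g :: "'a \<Rightarrow> real"
  assumes "f summable_on A" "g summable_on A"
  shows "infsum (\<lambda>x. f x - g x) A = infsum f A - infsum g A" "(\<lambda>x. f x - g x) summable_on A"
proof -
  have "((\<lambda>x. f x + - g x) has_sum (infsum f A + - infsum g A)) A"
    using assms by (intro has_sum_add has_sum_minusI) (auto simp: has_sum_iff)
  then show "infsum (\<lambda>x. f x - g x) A = infsum f A - infsum g A" "(\<lambda>x. f x - g x) summable_on A"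
    by (simp_all add: has_sum_iff)
qed

lemma l1_norm_nonneg: "0 \<le> l1_norm v"
  unfolding l1_norm_def by (intro infsum_nonneg) simp

lemma sum_abs_le_l1_norm:
  "v summable_on UNIV \<Longrightarrow> finite A \<Longrightarrow> (\<Sum>x\<in>A. \<bar>v x\<bar>) \<le> l1_norm v"
  unfolding l1_norm_def by (intro finite_sum_le_infsum) (auto simp: abs_summable_iff)

lemma abs_le_l1_norm: "v summable_on UNIV \<Longrightarrow> \<bar>v x\<bar> \<le> l1_norm v"
  using sum_abs_le_l1_norm[of v "{x}"] by simp

lemma l1_norm_le_finite_sums:
  "v summable_on UNIV \<Longrightarrow> (\<And>A. finite A \<Longrightarrow> (\<Sum>x\<in>A. \<bar>v x\<bar>) \<le> c) \<Longrightarrow> l1_norm v \<le> c"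
  unfolding l1_norm_def by (intro infsum_le_finite_sums) (auto simp: abs_summable_iff)

lemma l1_norm_triangle:
  assumes "u summable_on UNIV" "v summable_on UNIV"
  shows "l1_norm (\<lambda>x. u x + v x) \<le> l1_norm u + l1_norm v"
  unfolding l1_norm_def using assms
  by (subst infsum_add[symmetric])
     (auto simp: abs_summable_iff abs_triangle_ineq intro!: infsum_mono summable_on_add)

lemma l1_norm_cmult: "l1_norm (\<lambda>x. c * v x) = \<bar>c\<bar> * l1_norm v"
  unfolding l1_norm_def abs_mult by (rule infsum_cmult_right')

lemma bounded_mult_summable:
  fixes b v :: "'a \<Rightarrow> real"
  assumes "\<And>x. \<bar>b x\<bar> \<le> B" "v summable_on UNIV"
  shows "(\<lambda>x. b x * v x) summable_on UNIV"
    and "\<bar>\<Sum>\<^sub>\<infinity>x. b x * v x\<bar> \<le> B * l1_norm v"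
proof -
  have s: "(\<lambda>x. B * \<bar>v x\<bar>) summable_on UNIV"
    using assms(2) by (intro summable_on_cmult_right) (simp add: abs_summable_iff)
  have le: "\<bar>b x * v x\<bar> \<le> B * \<bar>v x\<bar>" for x
    using assms(1)[of x] by (simp add: abs_mult mult_right_mono)
  have "(\<lambda>x. \<bar>b x * v x\<bar>) summable_on UNIV"
    by (rule summable_on_comparison_test[OF s]) (use le in auto)
  then show summ: "(\<lambda>x. b x * v x) summable_on UNIV" by (simp only: abs_summable_iff)
  have "norm (\<Sum>\<^sub>\<infinity>x. b x * v x) \<le> (\<Sum>\<^sub>\<infinity>x. B * \<bar>v x\<bar>)"
    using le by (intro norm_infsum_le[OF has_sum_infsum[OF summ] has_sum_infsum[OF s]]) auto
  then show "\<bar>\<Sum>\<^sub>\<infinity>x. b x * v x\<bar> \<le> B * l1_norm v"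
    unfolding l1_norm_def by (simp add: infsum_cmult_right')
qed

text \<open>Coordinatewise convergence controls a finite set \<open>A\<close> that carries almost all of the norm of the
  limit. Outside \<open>A\<close> the norm of \<open>Q s\<close> is its full norm minus the part on \<open>A\<close>, hence small as well.\<close>

lemma scheffe_l1:
  fixes Q :: "'b \<Rightarrow> 'a \<Rightarrow> real"
  assumes lim: "\<And>x. ((\<lambda>s. Q s x) \<longlongrightarrow> v x) F"
    and Q: "\<And>s. Q s summable_on UNIV" and v: "v summable_on UNIV"
    and le: "\<forall>\<^sub>F s in F. l1_norm (Q s) \<le> q s" and q: "(q \<longlongrightarrow> l1_norm v) F"
  shows "((\<lambda>s. l1_norm (\<lambda>x. Q s x - v x)) \<longlongrightarrow> 0) F"
proof (rule order_tendstoI)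
  fix e :: real assume "e > 0"
  then obtain A where A: "finite A" "l1_norm v - e / 2 < (\<Sum>x\<in>A. \<bar>v x\<bar>)"
    using l1_norm_le_finite_sums[OF v, of "l1_norm v - e / 2"] by (force simp: not_less)
  define g where "g s = (\<Sum>x\<in>A. \<bar>Q s x - v x\<bar>) + (q s - (\<Sum>x\<in>A. \<bar>Q s x\<bar>)) + (l1_norm v - (\<Sum>x\<in>A. \<bar>v x\<bar>))" for s
  have "(g \<longlongrightarrow> (\<Sum>x\<in>A. \<bar>v x - v x\<bar>) + (l1_norm v - (\<Sum>x\<in>A. \<bar>v x\<bar>)) + (l1_norm v - (\<Sum>x\<in>A. \<bar>v x\<bar>))) F"
    unfolding g_def by (intro tendsto_intros lim q)
  moreover have "(\<Sum>x\<in>A. \<bar>v x - v x\<bar>) + (l1_norm v - (\<Sum>x\<in>A. \<bar>v x\<bar>)) + (l1_norm v - (\<Sum>x\<in>A. \<bar>v x\<bar>)) < e"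
    using A(2) by simp
  ultimately have "\<forall>\<^sub>F s in F. g s < e" by (rule order_tendstoD(2))
  then show "\<forall>\<^sub>F s in F. l1_norm (\<lambda>x. Q s x - v x) < e"
    using le
  proof eventually_elim
    case (elim s)
    have split: "(\<Sum>x\<in>B. f x) \<le> (\<Sum>x\<in>A. f x) + (\<Sum>x\<in>B - A. f x)"
      if "finite B" "\<And>x. 0 \<le> f x" for B and f :: "'a \<Rightarrow> real"
    proof -
      have "(\<Sum>x\<in>B. f x) = (\<Sum>x\<in>B \<inter> A. f x) + (\<Sum>x\<in>B - A. f x)"
        using that(1) by (metis sum.Int_Diff)
      also have "(\<Sum>x\<in>B \<inter> A. f x) \<le> (\<Sum>x\<in>A. f x)"
        using A(1) that(2) by (intro sum_mono2) auto
      finally show ?thesis by simp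
    qed
    have tail: "(\<Sum>x\<in>B - A. \<bar>f x\<bar>) \<le> l1_norm f - (\<Sum>x\<in>A. \<bar>f x\<bar>)"
      if "finite B" "f summable_on UNIV" for B and f :: "'a \<Rightarrow> real"
    proof -
      have "(\<Sum>x\<in>A \<union> (B - A). \<bar>f x\<bar>) = (\<Sum>x\<in>A. \<bar>f x\<bar>) + (\<Sum>x\<in>B - A. \<bar>f x\<bar>)"
        using A(1) that(1) by (intro sum.union_disjoint) auto
      then show ?thesis
        using sum_abs_le_l1_norm[OF that(2), of "A \<union> (B - A)"] A(1) that(1) by simp
    qed
    have "l1_norm (\<lambda>x. Q s x - v x) \<le> g s"
    proof (rule l1_norm_le_finite_sums)
      show "(\<lambda>x. Q s x - v x) summable_on UNIV"
        by (rule infsum_diff_real(2)[OF Q v])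
      fix B :: "'a set" assume B: "finite B"
      have "(\<Sum>x\<in>B. \<bar>Q s x - v x\<bar>) \<le> (\<Sum>x\<in>A. \<bar>Q s x - v x\<bar>) + (\<Sum>x\<in>B - A. \<bar>Q s x - v x\<bar>)"
        by (rule split[OF B]) simp
      also have "(\<Sum>x\<in>B - A. \<bar>Q s x - v x\<bar>) \<le> (\<Sum>x\<in>B - A. \<bar>Q s x\<bar> + \<bar>v x\<bar>)"
        by (intro sum_mono abs_triangle_ineq4)
      also have "\<dots> = (\<Sum>x\<in>B - A. \<bar>Q s x\<bar>) + (\<Sum>x\<in>B - A. \<bar>v x\<bar>)" by (rule sum.distrib)
      finally show "(\<Sum>x\<in>B. \<bar>Q s x - v x\<bar>) \<le> g s"
        using tail[OF B Q[of s]] tail[OF B v] elim(2) unfolding g_def by linarith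
    qed
    then show ?case using elim(1) by linarith
  qed
next
  fix e :: real assume "e < 0"
  then show "\<forall>\<^sub>F s in F. e < l1_norm (\<lambda>x. Q s x - v x)"
    by (intro always_eventually allI) (use l1_norm_nonneg in \<open>meson less_le_trans\<close>)
qed

lemma pmf_has_sum: "(pmf p has_sum 1) UNIV"
proof -
  have "pmf p summable_on UNIV"
    by (rule abs_summable_summable, unfold abs_summable_equivalent, rule pmf_abs_summable)
  moreover have "infsum (pmf p) UNIV = infsetsum (pmf p) UNIV"
    by (rule infsetsum_infsum[symmetric]) (rule pmf_abs_summable)
  moreover have "infsetsum (pmf p) UNIV = 1" by (rule infsetsum_pmf_eq_1) simp
  ultimately show ?thesis by (simp add: has_sum_iff)
qed

lemma pmf_summable: "pmf p summable_on UNIV"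
  using pmf_has_sum has_sum_imp_summable by blast

lemma pmf_diff_summable: "(\<lambda>x. pmf p x - pmf q x) summable_on UNIV"
  by (rule infsum_diff_real(2)[OF pmf_summable pmf_summable])

lemma l1_dist_triangle: "l1_dist p q \<le> l1_dist p r + l1_dist r q"
  using l1_norm_triangle[OF pmf_diff_summable[of p r] pmf_diff_summable[of r q]]
  by (simp add: l1_dist_def)

lemma l1_dist_sym: "l1_dist p q = l1_dist q p"
  by (simp add: l1_dist_def l1_norm_def abs_minus_commute)

section \<open>Differentiability of absolutely continuous curves of measures\<close>

lemma l1_difference_quotient_summable:
  assumes "v summable_on UNIV"
  shows "(\<lambda>x. (pmf (p s) x - pmf (p t) x) / (s - t) - v x) summable_on UNIV"
proof -
  have "(\<lambda>x. (pmf (p s) x - pmf (p t) x) * inverse (s - t)) summable_on UNIV"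
    by (intro summable_on_cmult_left pmf_diff_summable)
  from summable_on_add[OF this summable_on_uminus[THEN iffD2, OF assms]] show ?thesis
    by (simp add: divide_inverse)
qed

text \<open>A bounded weight is a continuous linear functional on \<open>\<ell>\<^sup>1\<close>, so it commutes with the derivative.\<close>

lemma has_l1_deriv_weighted:
  assumes "has_l1_deriv T p v t" and b: "\<And>x. \<bar>b x\<bar> \<le> B"
  shows "((\<lambda>s. \<Sum>\<^sub>\<infinity>x. b x * pmf (p s) x) has_real_derivative (\<Sum>\<^sub>\<infinity>x. b x * v x))
           (at t within {0..T})"
proof -
  have v: "v summable_on UNIV" using assms(1) by (simp add: has_l1_deriv_def abs_summable_iff)
  have lim: "((\<lambda>s. l1_norm (\<lambda>x. (pmf (p s) x - pmf (p t) x) / (s - t) - v x)) \<longlongrightarrow> 0)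
      (at t within {0..T})"
    using assms(1) by (simp add: has_l1_deriv_def)
  define S where "S s = (\<Sum>\<^sub>\<infinity>x. b x * pmf (p s) x)" for s
  have S: "((\<lambda>x. b x * pmf (p s) x) has_sum S s) UNIV" for s
    unfolding S_def using bounded_mult_summable(1)[OF b pmf_summable] by (rule has_sum_infsum)
  have D: "((\<lambda>x. b x * v x) has_sum (\<Sum>\<^sub>\<infinity>x. b x * v x)) UNIV"
    using bounded_mult_summable(1)[OF b v] by (rule has_sum_infsum)
  have "((\<lambda>x. inverse (s - t) * (b x * pmf (p s) x + - (b x * pmf (p t) x)) + - (b x * v x))
      has_sum (inverse (s - t) * (S s + - S t) + - (\<Sum>\<^sub>\<infinity>x. b x * v x))) UNIV" for s
    by (intro has_sum_add has_sum_cmult_right S D has_sum_minusI)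
  then have "(\<Sum>\<^sub>\<infinity>x. b x * ((pmf (p s) x - pmf (p t) x) / (s - t) - v x))
      = (S s - S t) / (s - t) - (\<Sum>\<^sub>\<infinity>x. b x * v x)" for s
    by (intro infsumI) (simp add: algebra_simps divide_inverse)
  then have bound: "\<bar>(S s - S t) / (s - t) - (\<Sum>\<^sub>\<infinity>x. b x * v x)\<bar>
      \<le> B * l1_norm (\<lambda>x. (pmf (p s) x - pmf (p t) x) / (s - t) - v x)" for s
    using bounded_mult_summable(2)[where b = b and B = B, OF b l1_difference_quotient_summable[OF v, where p = p and s = s and t = t]] by simp
  have "((\<lambda>s. (S s - S t) / (s - t) - (\<Sum>\<^sub>\<infinity>x. b x * v x)) \<longlongrightarrow> 0) (at t within {0..T})"
    by (rule Lim_null_comparison[OF _ tendsto_mult_right_zero[OF lim, of B]])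
       (use bound in \<open>auto intro: always_eventually\<close>)
  then show ?thesis
    unfolding has_field_derivative_iff S_def by (rule LIM_zero_cancel)
qed

lemma has_l1_deriv_coordinate:
  assumes "has_l1_deriv T p v t"
  shows "((\<lambda>s. pmf (p s) x) has_real_derivative v x) (at t within {0..T})"
proof -
  have v: "v summable_on UNIV" using assms(1) by (simp add: has_l1_deriv_def abs_summable_iff)
  have lim: "((\<lambda>s. l1_norm (\<lambda>x. (pmf (p s) x - pmf (p t) x) / (s - t) - v x)) \<longlongrightarrow> 0)
      (at t within {0..T})"
    using assms(1) by (simp add: has_l1_deriv_def)
  have "((\<lambda>s. (pmf (p s) x - pmf (p t) x) / (s - t) - v x) \<longlongrightarrow> 0) (at t within {0..T})"
    by (rule Lim_null_comparison[OF _ lim])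
       (use abs_le_l1_norm[OF l1_difference_quotient_summable[OF v]] in \<open>auto intro: always_eventually\<close>)
  then show ?thesis
    unfolding has_field_derivative_iff by (rule LIM_zero_cancel)
qed

lemma at_within_Icc_neq_bot: "0 < T \<Longrightarrow> t \<in> {0..T} \<Longrightarrow> at t within {0..T::real} \<noteq> bot"
  by (simp add: trivial_limit_within islimpt_Icc)

lemma l1_deriv_eqI:
  assumes "has_l1_deriv T p v t" "0 < T" "t \<in> {0..T}"
  shows "l1_deriv T p t = v"
  unfolding l1_deriv_def
proof (rule the_equality)
  show "has_l1_deriv T p v t" by fact
  fix u assume u: "has_l1_deriv T p u t"
  show "u = v"
  proof
    fix x
    show "u x = v x"
      using has_l1_deriv_coordinate[OF u, of x] has_l1_deriv_coordinate[OF assms(1), of x]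
        at_within_Icc_neq_bot[OF assms(2,3)]
      unfolding has_field_derivative_iff by (rule tendsto_unique[rotated])
  qed
qed

text \<open>An unordered sum of nonnegative terms as a supremum over the countably many finite sets of indices:
  in this form measurability in \<open>t\<close> is evident, also at those \<open>t\<close> where the sum diverges.\<close>

definition finite_sums_sup :: "('a \<Rightarrow> real \<Rightarrow> real) \<Rightarrow> real \<Rightarrow> ennreal" where
  "finite_sums_sup f t = (SUP A\<in>{A. finite A}. ennreal (\<Sum>x\<in>A. f x t))"

lemma finite_sums_sup_measurable:
  fixes f :: "'a::countable \<Rightarrow> real \<Rightarrow> real"
  assumes [measurable]: "\<And>x. f x \<in> borel_measurable borel"
  shows "finite_sums_sup f \<in> borel_measurable borel"
  unfolding finite_sums_sup_def
  by (intro borel_measurable_SUP countable_Collect_finite) measurable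

lemma finite_sums_sup_eq:
  assumes "\<And>x. 0 \<le> f x t" "(\<lambda>x. f x t) summable_on UNIV"
  shows "finite_sums_sup f t = ennreal (\<Sum>\<^sub>\<infinity>x. f x t)"
  unfolding finite_sums_sup_def using assms
  by (subst infsum_nonneg_is_SUPREMUM_ennreal) auto

lemma ac_curve_imp_ac_distance:
  assumes "ac_curve T p"
  shows "ac_distance T (\<lambda>u v. l1_dist (p v) (p u))"
  unfolding ac_distance_def
proof (intro allI impI)
  fix e :: real assume "e > 0"
  from assms[unfolded ac_curve_def, THEN spec, THEN mp, OF this]
  obtain d where d: "d > 0" and
    small: "\<forall>I. finite I \<and> (\<forall>(a, b)\<in>I. 0 \<le> a \<and> a \<le> b \<and> b \<le> T) \<and>
        (\<forall>i\<in>I. \<forall>j\<in>I. i \<noteq> j \<longrightarrow> {fst i<..<snd i} \<inter> {fst j<..<snd j} = {}) \<and>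
        (\<Sum>(a, b)\<in>I. b - a) < d \<longrightarrow> (\<Sum>(a, b)\<in>I. l1_dist (p b) (p a)) < e"
    by (elim exE conjE)
  show "\<exists>d>0. \<forall>I. nonoverlapping 0 T I \<and> (\<Sum>(u, v)\<in>I. v - u) < d \<longrightarrow>
      (\<Sum>(u, v)\<in>I. l1_dist (p v) (p u)) < e"
  proof (intro exI[of _ d] conjI allI impI)
    fix I assume I: "nonoverlapping 0 T I \<and> (\<Sum>(u, v)\<in>I. v - u) < d"
    then have "\<forall>(a, b)\<in>I. 0 \<le> a \<and> a \<le> b \<and> b \<le> T"
      by (auto simp: nonoverlapping_def)
    with I show "(\<Sum>(u, v)\<in>I. l1_dist (p v) (p u)) < e"
      by (intro small[THEN spec, THEN mp]) (simp add: nonoverlapping_def)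
  qed (rule d)
qed

lemma ac_distance_le:
  assumes ac: "ac_distance T d" and c: "c > 0"
    and le: "\<And>u v. 0 \<le> u \<Longrightarrow> u < v \<Longrightarrow> v \<le> T \<Longrightarrow> d' u v \<le> c * d u v"
  shows "ac_distance T d'"
  unfolding ac_distance_def
proof (intro allI impI)
  fix e :: real assume "e > 0"
  then have "e / c > 0" using c by simp
  then obtain \<delta> where \<delta>: "\<delta> > 0"
    "\<And>I. nonoverlapping 0 T I \<Longrightarrow> (\<Sum>(u, v)\<in>I. v - u) < \<delta> \<Longrightarrow> (\<Sum>(u, v)\<in>I. d u v) < e / c"
    using ac unfolding ac_distance_def by blast
  have "(\<Sum>(u, v)\<in>I. d' u v) < e" if I: "nonoverlapping 0 T I" "(\<Sum>(u, v)\<in>I. v - u) < \<delta>" for I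
  proof -
    have "(\<Sum>(u, v)\<in>I. d' u v) \<le> (\<Sum>(u, v)\<in>I. c * d u v)"
    proof (rule sum_mono)
      fix i assume "i \<in> I"
      then show "(case i of (u, v) \<Rightarrow> d' u v) \<le> (case i of (u, v) \<Rightarrow> c * d u v)"
        using I(1) le[of "fst i" "snd i"] by (auto simp: nonoverlapping_def)
    qed
    also have "\<dots> = c * (\<Sum>(u, v)\<in>I. d u v)" by (simp add: sum_distrib_left case_prod_unfold)
    also have "\<dots> < c * (e / c)" using \<delta>(2)[OF I] c by (rule mult_strict_left_mono)
    finally show ?thesis using c by simp
  qed
  then show "\<exists>\<delta>>0. \<forall>I. nonoverlapping 0 T I \<and> (\<Sum>(u, v)\<in>I. v - u) < \<delta> \<longrightarrow> (\<Sum>(u, v)\<in>I. d' u v) < e"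
    using \<delta>(1) by blast
qed

text \<open>Let \<open>V\<close> be the variation of the curve, with derivative \<open>w\<close>, and let \<open>v x\<close> be the derivative of
  coordinate \<open>x\<close>. Difference quotients show \<open>\<Sum>\<^sub>x \<bar>v x t\<bar> \<le> w t\<close>, so \<open>U = \<Sum>\<^sub>x \<bar>v x\<bar>\<close> is integrable.
  Increments of the curve are bounded in norm by the integral of \<open>U\<close>, and at a point of
  differentiability of that integral the norms of the difference quotients are asymptotically at
  most the norm of \<open>v\<close>, as Scheffe's argument needs.\<close>

theorem ac_curve_has_l1_deriv:
  fixes p :: "real \<Rightarrow> 'a::countable pmf"
  assumes T: "T > 0" and p: "ac_curve T p"
  shows "AE t in lborel. t \<in> {0..T} \<longrightarrow> has_l1_deriv T p (l1_deriv T p t) t"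
proof -
  have ac: "ac_distance T (\<lambda>u v. l1_dist (p v) (p u))" by (rule ac_curve_imp_ac_distance[OF p])
  have dist_nonneg: "0 \<le> l1_dist q r" for q r :: "'a pmf" by (simp add: l1_dist_def l1_norm_nonneg)
  interpret ac_pseudometric T "\<lambda>u v. l1_dist (p v) (p u)"
  proof
    show "l1_dist (p v) (p u) \<le> l1_dist (p w) (p u) + l1_dist (p v) (p w)" for u v w
      using l1_dist_triangle[of "p v" "p u" "p w"] by linarith
    show "l1_dist (p u) (p u) = 0" for u by (simp add: l1_dist_def l1_norm_def)
    show "ac_distance T (\<lambda>u v. l1_dist (p v) (p u))" by (rule ac)
  qed (rule dist_nonneg)

  define V where "V = variation 0"
  have V: "l1_dist (p v) (p u) \<le> V v - V u" if "0 \<le> u" "u \<le> v" "v \<le> T" for u v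
    using that variation_ge variation_increment by (simp add: V_def)
  have "ac_distance T (\<lambda>u v. \<bar>V v - V u\<bar>)"
  proof (rule ac_distance_le[of _ "\<lambda>u v. V v - V u" 1])
    show "ac_distance T (\<lambda>u v. V v - V u)" unfolding V_def by (rule variation_ac)
    show "\<bar>V v - V u\<bar> \<le> 1 * (V v - V u)" if "0 \<le> u" "u < v" "v \<le> T" for u v
      using V[of u v] dist_nonneg[of "p v" "p u"] that by simp
  qed simp
  then obtain w where w: "integrable lborel w"
    "AE t in lborel. t \<in> {0..T} \<longrightarrow> (V has_real_derivative w t) (at t within {0..T})"
    by (rule ac_function_density[OF T]) blast

  have coord: "\<bar>pmf (p v) x - pmf (p u) x\<bar> \<le> l1_dist (p v) (p u)" for u v x
    unfolding l1_dist_def by (rule abs_le_l1_norm[OF pmf_diff_summable])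
  define is_density where "is_density x f \<longleftrightarrow> f \<in> borel_measurable borel \<and> integrable lborel f \<and>
      (\<forall>a b. 0 \<le> a \<longrightarrow> a \<le> b \<longrightarrow> b \<le> T \<longrightarrow> pmf (p b) x - pmf (p a) x = (LBINT t:{a..b}. f t)) \<and>
      (AE t in lborel. t \<in> {0..T} \<longrightarrow> ((\<lambda>s. pmf (p s) x) has_real_derivative f t) (at t within {0..T}))"
    for x f
  have "\<exists>f. is_density x f" for x
  proof -
    have "ac_distance T (\<lambda>u v. \<bar>pmf (p v) x - pmf (p u) x\<bar>)"
      by (rule ac_distance_le[OF ac, of 1]) (simp_all add: coord)
    then show ?thesis
    proof (rule ac_function_density[OF T])
      fix f assume f: "f \<in> borel_measurable borel" "integrable lborel f"
        "\<And>a b. 0 \<le> a \<Longrightarrow> a \<le> b \<Longrightarrow> b \<le> T \<Longrightarrow> pmf (p b) x - pmf (p a) x = (LBINT t:{a..b}. f t)"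
        "AE t in lborel. t \<in> {0..T} \<longrightarrow> ((\<lambda>s. pmf (p s) x) has_real_derivative f t) (at t within {0..T})"
      show ?thesis
        unfolding is_density_def using f(1,2,4) by (intro exI[of _ f] conjI allI impI f(3))
    qed
  qed
  then obtain v where "\<And>x. is_density x (v x)" by metis
  note v_props = this[unfolded is_density_def]
  have v: "v x \<in> borel_measurable borel" "integrable lborel (v x)"
    "0 \<le> a \<Longrightarrow> a \<le> b \<Longrightarrow> b \<le> T \<Longrightarrow> pmf (p b) x - pmf (p a) x = (LBINT t:{a..b}. v x t)"
    "AE t in lborel. t \<in> {0..T} \<longrightarrow> ((\<lambda>s. pmf (p s) x) has_real_derivative v x t) (at t within {0..T})"
    for x a b
    using v_props[of x] by simp_all

  have sum_le: "(\<Sum>x\<in>A. \<bar>v x t\<bar>) \<le> w t"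
    if t: "t \<in> {0..T}" and dV: "(V has_real_derivative w t) (at t within {0..T})"
      and dv: "\<And>x. ((\<lambda>s. pmf (p s) x) has_real_derivative v x t) (at t within {0..T})"
      and A: "finite A" for t A
  proof (rule tendsto_le[OF at_within_Icc_neq_bot[OF T t]])
    show "((\<lambda>s. (V s - V t) / (s - t)) \<longlongrightarrow> w t) (at t within {0..T})"
      using dV by (simp add: has_field_derivative_iff)
    show "((\<lambda>s. \<Sum>x\<in>A. \<bar>(pmf (p s) x - pmf (p t) x) / (s - t)\<bar>) \<longlongrightarrow> (\<Sum>x\<in>A. \<bar>v x t\<bar>)) (at t within {0..T})"
      using dv by (intro tendsto_sum tendsto_rabs) (simp add: has_field_derivative_iff)
    have "(\<Sum>x\<in>A. \<bar>(pmf (p s) x - pmf (p t) x) / (s - t)\<bar>) \<le> (V s - V t) / (s - t)"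
      if s: "s \<in> {0..T}" "s \<noteq> t" for s
    proof -
      have "(\<Sum>x\<in>A. \<bar>(pmf (p s) x - pmf (p t) x) / (s - t)\<bar>)
          = (\<Sum>x\<in>A. \<bar>pmf (p s) x - pmf (p t) x\<bar>) / \<bar>s - t\<bar>"
        by (simp add: sum_divide_distrib)
      also have "\<dots> \<le> l1_dist (p s) (p t) / \<bar>s - t\<bar>"
        unfolding l1_dist_def by (intro divide_right_mono sum_abs_le_l1_norm pmf_diff_summable A) simp
      also have "\<dots> \<le> (V s - V t) / (s - t)"
      proof (cases "s < t")
        case True
        then have "(V s - V t) / (s - t) = (V t - V s) / \<bar>s - t\<bar>"
          using minus_divide_divide[of "V t - V s" "t - s"] by simp
        then show ?thesis
          using V[of s t] s t True l1_dist_sym[of "p s" "p t"] by (simp add: divide_right_mono)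
      next
        case False
        then show ?thesis using V[of t s] s t by (simp add: divide_right_mono)
      qed
      finally show ?thesis .
    qed
    then show "\<forall>\<^sub>F s in at t within {0..T}.
        (\<Sum>x\<in>A. \<bar>(pmf (p s) x - pmf (p t) x) / (s - t)\<bar>) \<le> (V s - V t) / (s - t)"
      by (auto simp: eventually_at_filter)
  qed
  have AE_deriv: "AE t in lborel. \<forall>x. t \<in> {0..T} \<longrightarrow> ((\<lambda>s. pmf (p s) x) has_real_derivative v x t) (at t within {0..T})"
    by (subst AE_all_countable) (use v(4) in blast)
  have AE_sum: "AE t in lborel. t \<in> {0..T} \<longrightarrow> (\<forall>A. finite A \<longrightarrow> (\<Sum>x\<in>A. \<bar>v x t\<bar>) \<le> w t)"
    using w(2) AE_deriv by eventually_elim (use sum_le in blast)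
  have summ: "(\<lambda>x. v x t) summable_on UNIV" if "\<forall>A. finite A \<longrightarrow> (\<Sum>x\<in>A. \<bar>v x t\<bar>) \<le> w t" for t
  proof -
    have "(\<lambda>x. \<bar>v x t\<bar>) summable_on UNIV"
      using that by (intro nonneg_bdd_above_summable_on) (auto intro!: bdd_aboveI[of _ "w t"])
    then show ?thesis by (simp add: abs_summable_iff)
  qed

  define U where "U t = indicator {0..T} t * enn2real (finite_sums_sup (\<lambda>x t. \<bar>v x t\<bar>) t)" for t
  have [measurable]: "finite_sums_sup (\<lambda>x t. \<bar>v x t\<bar>) \<in> borel_measurable borel"
    using v(1) by (intro finite_sums_sup_measurable) measurable
  have [measurable]: "U \<in> borel_measurable borel"
    unfolding U_def by measurable
  have U_eq: "U t = l1_norm (\<lambda>x. v x t)"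
    if "t \<in> {0..T}" "\<forall>A. finite A \<longrightarrow> (\<Sum>x\<in>A. \<bar>v x t\<bar>) \<le> w t" for t
    using that summ[OF that(2)]
    by (simp add: U_def l1_norm_def finite_sums_sup_eq abs_summable_iff infsum_nonneg)
  have "integrable lborel U"
  proof (rule Bochner_Integration.integrable_bound[OF w(1)])
    show "AE t in lborel. norm (U t) \<le> norm (w t)"
      using AE_sum
    proof eventually_elim
      case (elim t)
      show ?case
      proof (cases "t \<in> {0..T}")
        case True
        then have "l1_norm (\<lambda>x. v x t) \<le> w t"
          using elim summ by (intro l1_norm_le_finite_sums) auto
        then show ?thesis using U_eq[OF True] elim True l1_norm_nonneg[of "\<lambda>x. v x t"] by simp
      qed (simp add: U_def)
    qed
  qed simp
  \<comment> \<open>increments of the curve in terms of the integrable function \<open>U\<close>\<close>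
  have increment: "l1_norm (\<lambda>x. pmf (p b) x - pmf (p a) x) \<le> (LBINT t:{a..b}. U t)"
    if ab: "0 \<le> a" "a \<le> b" "b \<le> T" for a b
  proof (rule l1_norm_le_finite_sums[OF pmf_diff_summable])
    fix A :: "'a set" assume A: "finite A"
    have int: "set_integrable lborel {a..b} (\<lambda>t. \<bar>v x t\<bar>)" for x
      using v(2)[of x] by (intro integrable_imp_set_integrable) auto
    have "(\<Sum>x\<in>A. \<bar>pmf (p b) x - pmf (p a) x\<bar>) = (\<Sum>x\<in>A. \<bar>LBINT t:{a..b}. v x t\<bar>)"
      using v(3)[OF ab] by simp
    also have "\<dots> \<le> (\<Sum>x\<in>A. (LBINT t:{a..b}. \<bar>v x t\<bar>))"
      using set_integral_norm_bound[OF integrable_imp_set_integrable[OF v(2)], of "{a..b}"]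
      by (intro sum_mono) simp
    also have "\<dots> = (LBINT t:{a..b}. (\<Sum>x\<in>A. \<bar>v x t\<bar>))"
      using int unfolding set_lebesgue_integral_def set_integrable_def
      by (subst Bochner_Integration.integral_sum[symmetric]) (auto simp: sum_distrib_left)
    also have "\<dots> \<le> (LBINT t:{a..b}. U t)"
    proof (rule set_integral_mono_AE)
      show "set_integrable lborel {a..b} (\<lambda>t. \<Sum>x\<in>A. \<bar>v x t\<bar>)"
        using v(2) by (intro integrable_imp_set_integrable) auto
      show "set_integrable lborel {a..b} U"
        using \<open>integrable lborel U\<close> by (intro integrable_imp_set_integrable) auto
      show "AE t\<in>{a..b} in lborel. (\<Sum>x\<in>A. \<bar>v x t\<bar>) \<le> U t"
        using AE_sum
      proof eventually_elim
        case (elim t)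
        show ?case
          using elim ab A U_eq[of t] sum_abs_le_l1_norm[of "\<lambda>x. v x t" A] summ[of t] by auto
      qed
    qed
    finally show "(\<Sum>x\<in>A. \<bar>pmf (p b) x - pmf (p a) x\<bar>) \<le> (LBINT t:{a..b}. U t)" .
  qed

  show ?thesis
    using AE_deriv AE_sum lebesgue_differentiation[OF \<open>integrable lborel U\<close>]
  proof eventually_elim
    case (elim t)
    show ?case
    proof
      assume t: "t \<in> {0..T}"
      have v_sum: "(\<lambda>x. v x t) summable_on UNIV" using summ elim(2) t by blast
      have "((\<lambda>s. l1_norm (\<lambda>x. (pmf (p s) x - pmf (p t) x) / (s - t) - v x t)) \<longlongrightarrow> 0) (at t within {0..T})"
      proof (rule scheffe_l1[OF _ _ v_sum])
        show "((\<lambda>s. (pmf (p s) x - pmf (p t) x) / (s - t)) \<longlongrightarrow> v x t) (at t within {0..T})" for x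
          using elim(1) t by (simp add: has_field_derivative_iff)
        show "(\<lambda>x. (pmf (p s) x - pmf (p t) x) / (s - t)) summable_on UNIV" for s
          using l1_difference_quotient_summable[of "\<lambda>_. 0" p s t] by simp
        show "((\<lambda>s. (LBINT r:{min s t..max s t}. U r) / \<bar>s - t\<bar>) \<longlongrightarrow> l1_norm (\<lambda>x. v x t)) (at t within {0..T})"
          using elim(2,3) t U_eq[of t] by (auto intro: tendsto_within_subset)
        have "l1_norm (\<lambda>x. (pmf (p s) x - pmf (p t) x) / (s - t)) \<le> (LBINT r:{min s t..max s t}. U r) / \<bar>s - t\<bar>"
          if s: "s \<in> {0..T}" for s
        proof -
          have "l1_norm (\<lambda>x. (pmf (p s) x - pmf (p t) x) / (s - t)) = l1_dist (p s) (p t) / \<bar>s - t\<bar>"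
            using l1_norm_cmult[of "inverse (s - t)" "\<lambda>x. pmf (p s) x - pmf (p t) x"]
            by (simp add: l1_dist_def divide_inverse mult.commute)
          also have "l1_dist (p s) (p t) \<le> (LBINT r:{min s t..max s t}. U r)"
            using increment[of s t] increment[of t s] s t l1_dist_sym[of "p s" "p t"]
            by (cases "s \<le> t") (auto simp: l1_dist_def)
          finally show ?thesis by (simp add: divide_right_mono)
        qed
        then show "\<forall>\<^sub>F s in at t within {0..T}.
            l1_norm (\<lambda>x. (pmf (p s) x - pmf (p t) x) / (s - t)) \<le> (LBINT r:{min s t..max s t}. U r) / \<bar>s - t\<bar>"
          by (auto simp: eventually_at_filter)
      qed
      then have "has_l1_deriv T p (\<lambda>x. v x t) t"
        using v_sum by (simp add: has_l1_deriv_def abs_summable_iff)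
      moreover from l1_deriv_eqI[OF this T t] have "l1_deriv T p t = (\<lambda>x. v x t)" .
      ultimately show "has_l1_deriv T p (l1_deriv T p t) t" by simp
    qed
  qed
qed

section \<open>The truncated logarithm and its entropy\<close>

text \<open>The logarithm of \<open>m / r\<close> clamped to \<open>[-n, n]\<close>. The thresholds are written without division, so that
  a state with \<open>r = 0 < m\<close> gets the value \<open>n\<close>, the limit for \<open>r\<close> tending to zero. At \<open>m = r = 0\<close>
  every value in \<open>[-n, n]\<close> is optimal in the sense of \<open>trunc_entropy\<close>, and \<open>n\<close> is taken.\<close>

definition trunc_log :: "real \<Rightarrow> real \<Rightarrow> real \<Rightarrow> real" where
  "trunc_log n m r = (if exp n * r \<le> m then n else if m \<le> exp (- n) * r then - n else ln (m / r))"

text \<open>The maximum of \<open>m \<eta> - r (e\<^sup>\<eta> - 1)\<close> over \<open>\<bar>\<eta>\<bar> \<le> n\<close>, attained at the truncated logarithm. If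
  \<open>r > 0\<close>, it tends for \<open>n\<close> tending to infinity to \<open>m ln (m / r) - m + r\<close>, the Legendre dual of \<open>r (e\<^sup>\<eta> - 1)\<close>.\<close>

definition trunc_entropy :: "real \<Rightarrow> real \<Rightarrow> real \<Rightarrow> real" where
  "trunc_entropy n m r = m * trunc_log n m r - r * (exp (trunc_log n m r) - 1)"

text \<open>The summand of the Fisher information with \<open>f(x) = m / r\<close> and \<open>f(y) = m' / r'\<close> replaced by the
  exponentials of the truncated logarithms, while the weights \<open>r\<close> and \<open>m\<close> remain untruncated.\<close>

definition trunc_fisher :: "real \<Rightarrow> real \<Rightarrow> real \<Rightarrow> real \<Rightarrow> real \<Rightarrow> real \<Rightarrow> real" where
  "trunc_fisher lam n m r m' r' =
     r * (exp (trunc_log n m' r') - exp (trunc_log n m r))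
       - m / lam * (exp (lam * (trunc_log n m' r' - trunc_log n m r)) - 1)"

lemma trunc_log_cases:
  assumes "0 \<le> n" "0 \<le> m" "0 \<le> r"
  obtains "trunc_log n m r = n" "exp n * r \<le> m"
  | "trunc_log n m r = - n" "m \<le> exp (- n) * r"
  | "0 < m" "0 < r" "trunc_log n m r = ln (m / r)" "- n < ln (m / r)" "ln (m / r) < n"
      "r * exp (trunc_log n m r) = m"
proof (cases "exp n * r \<le> m \<or> m \<le> exp (- n) * r")
  case True
  then show thesis
    using that(1,2) by (cases "exp n * r \<le> m") (auto simp: trunc_log_def)
next
  case False
  then have lt: "m < exp n * r" "exp (- n) * r < m" by auto
  then have "0 < r" using assms(2,3) by (cases "r = 0") auto
  then have "0 < m" using lt(2) by (smt (verit) exp_gt_zero mult_pos_pos)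
  have "exp (- n) < m / r" "m / r < exp n" using lt \<open>0 < r\<close> by (auto simp: field_simps)
  then have "- n < ln (m / r)" "ln (m / r) < n"
    using \<open>0 < m\<close> \<open>0 < r\<close> ln_less_cancel_iff[of "exp (- n)" "m / r"]
      ln_less_cancel_iff[of "m / r" "exp n"] by simp_all
  moreover have "trunc_log n m r = ln (m / r)" using False by (simp add: trunc_log_def)
  ultimately show thesis using that(3) \<open>0 < m\<close> \<open>0 < r\<close> by simp
qed

lemma trunc_log_bounds:
  assumes "0 \<le> n" "0 \<le> m" "0 \<le> r"
  shows "- n \<le> trunc_log n m r" "trunc_log n m r \<le> n"
  using assms by (rule trunc_log_cases; simp)+

text \<open>First-order optimality of the truncated logarithm for the concave function
  \<open>\<eta> \<mapsto> m \<eta> - r (e\<^sup>\<eta> - 1)\<close> on \<open>[-n, n]\<close>.\<close>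

lemma trunc_log_variational:
  assumes "0 \<le> n" "0 \<le> m" "0 \<le> r" "- n \<le> \<eta>" "\<eta> \<le> n"
  shows "0 \<le> (r * exp (trunc_log n m r) - m) * (\<eta> - trunc_log n m r)"
  using assms(1-3)
proof (rule trunc_log_cases)
  assume "trunc_log n m r = n" "exp n * r \<le> m"
  then show ?thesis using assms(5) by (intro mult_nonpos_nonpos) (auto simp: mult.commute)
next
  assume "trunc_log n m r = - n" "m \<le> exp (- n) * r"
  then show ?thesis using assms(4) by (intro mult_nonneg_nonneg) (auto simp: mult.commute)
qed simp

lemma trunc_entropy_ge:
  assumes "0 \<le> n" "0 \<le> m" "0 \<le> r" "- n \<le> \<eta>" "\<eta> \<le> n"
  shows "m * \<eta> - r * (exp \<eta> - 1) \<le> trunc_entropy n m r"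
proof -
  define \<xi> where "\<xi> = trunc_log n m r"
  have "exp \<xi> * (1 + (\<eta> - \<xi>)) \<le> exp \<xi> * exp (\<eta> - \<xi>)"
    by (intro mult_left_mono exp_ge_add_one_self) simp
  then have "exp \<xi> * (1 + (\<eta> - \<xi>)) \<le> exp \<eta>" by (simp flip: exp_add)
  then have "r * (exp \<xi> * (1 + (\<eta> - \<xi>))) \<le> r * exp \<eta>" using assms(3) by (rule mult_left_mono)
  moreover have "0 \<le> (r * exp \<xi> - m) * (\<eta> - \<xi>)"
    unfolding \<xi>_def using assms by (rule trunc_log_variational)
  ultimately show ?thesis
    unfolding trunc_entropy_def \<xi>_def[symmetric] by (simp add: algebra_simps)
qed

lemma trunc_entropy_nonneg: "0 \<le> n \<Longrightarrow> 0 \<le> m \<Longrightarrow> 0 \<le> r \<Longrightarrow> 0 \<le> trunc_entropy n m r"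
  using trunc_entropy_ge[of n m r 0] by simp

lemma trunc_entropy_subgradient:
  assumes "0 \<le> n" "0 \<le> m" "0 \<le> r" "0 \<le> m'" "0 \<le> r'"
  shows "trunc_entropy n m r + trunc_log n m r * (m' - m) - (exp (trunc_log n m r) - 1) * (r' - r)
    \<le> trunc_entropy n m' r'"
  using trunc_entropy_ge[OF assms(1,4,5) trunc_log_bounds[OF assms(1-3)]]
  by (simp add: trunc_entropy_def algebra_simps)

lemma exp_minus_one_bound: "- n \<le> \<xi> \<Longrightarrow> \<xi> \<le> n \<Longrightarrow> 0 \<le> n \<Longrightarrow> \<bar>exp \<xi> - 1\<bar> \<le> exp (n::real)"
proof -
  assume "- n \<le> \<xi>" "\<xi> \<le> n" "0 \<le> n"
  then have "exp \<xi> \<le> exp n" "1 \<le> exp n" "0 < exp \<xi>" by auto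
  then show ?thesis by linarith
qed

lemma trunc_entropy_lipschitz_aux:
  assumes "0 \<le> n" "0 \<le> m" "0 \<le> r" "0 \<le> m'" "0 \<le> r'"
  shows "trunc_entropy n m r - trunc_entropy n m' r' \<le> n * \<bar>m' - m\<bar> + exp n * \<bar>r' - r\<bar>"
proof -
  let ?\<xi> = "trunc_log n m r"
  note b = trunc_log_bounds[OF assms(1-3)]
  have "\<bar>?\<xi> * (m' - m)\<bar> \<le> n * \<bar>m' - m\<bar>"
    unfolding abs_mult using b by (intro mult_right_mono) auto
  moreover have "\<bar>(exp ?\<xi> - 1) * (r' - r)\<bar> \<le> exp n * \<bar>r' - r\<bar>"
    unfolding abs_mult using exp_minus_one_bound[OF b assms(1)] by (intro mult_right_mono) auto
  ultimately show ?thesis using trunc_entropy_subgradient[OF assms] by linarith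
qed

lemma trunc_entropy_lipschitz:
  assumes "0 \<le> n" "0 \<le> m" "0 \<le> r" "0 \<le> m'" "0 \<le> r'"
  shows "\<bar>trunc_entropy n m' r' - trunc_entropy n m r\<bar> \<le> n * \<bar>m' - m\<bar> + exp n * \<bar>r' - r\<bar>"
  using trunc_entropy_lipschitz_aux[OF assms] trunc_entropy_lipschitz_aux[OF assms(1,4,5,2,3)]
  by (simp add: abs_minus_commute abs_le_iff)

text \<open>Without truncation, \<open>m = r e\<^sup>\<xi>\<close> and the claim is \<open>e\<^sup>z - 1 \<ge> (e\<^bsup>\<lambda>z\<^esup> - 1) / \<lambda>\<close> for \<open>z = \<xi>' - \<xi>\<close>, by
  convexity of the exponential. Where the truncation is active, \<open>m\<close> and \<open>r e\<^sup>\<xi>\<close> differ, but the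
  optimality condition fixes the sign of the error: at the upper end \<open>z \<le> 0\<close>, at the lower end
  \<open>z \<ge> 0\<close>.\<close>

lemma trunc_fisher_nonneg:
  assumes "0 \<le> n" "0 \<le> m" "0 \<le> r" "0 \<le> m'" "0 \<le> r'" and lam: "0 < lam" "lam < 1"
  shows "0 \<le> trunc_fisher lam n m r m' r'"
proof -
  define \<xi> \<xi>' z where "\<xi> = trunc_log n m r" and "\<xi>' = trunc_log n m' r'" and "z = \<xi>' - \<xi>"
  have "exp ((1 - lam) * 0 + lam * z) \<le> (1 - lam) * exp 0 + lam * exp z"
    using convex_onD[OF exp_convex, of lam 0 z] lam by simp
  then have "exp (lam * z) - 1 \<le> lam * (exp z - 1)" by (simp add: algebra_simps)
  then have "r * exp \<xi> * ((exp (lam * z) - 1) / lam) \<le> r * exp \<xi> * (exp z - 1)"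
    using lam assms(3) by (intro mult_left_mono) (auto simp: field_simps)
  also have "r * exp \<xi> * (exp z - 1) = r * (exp \<xi>' - exp \<xi>)"
    by (simp add: z_def algebra_simps flip: exp_add)
  finally have 1: "r * exp \<xi> * ((exp (lam * z) - 1) / lam) \<le> r * (exp \<xi>' - exp \<xi>)" .
  have 2: "0 \<le> (r * exp \<xi> - m) * (exp (lam * z) - 1)"
  proof -
    \<comment> \<open>\<open>z\<close> and \<open>e\<^bsup>\<lambda>z\<^esup> - 1\<close> have the same sign, so the optimality condition carries over\<close>
    have *: "0 \<le> (r * exp \<xi> - m) * z"
      unfolding z_def \<xi>_def
      using trunc_log_bounds[OF assms(1,4,5)] assms by (intro trunc_log_variational) (auto simp: \<xi>'_def)
    show ?thesis
    proof (cases "z \<ge> 0")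
      case True
      then have "0 \<le> exp (lam * z) - 1" using lam by simp
      moreover have "r * exp \<xi> - m \<ge> 0 \<or> z = 0" using * True by (auto simp: zero_le_mult_iff)
      ultimately show ?thesis by auto
    next
      case False
      then have "exp (lam * z) - 1 \<le> 0" using lam by (simp add: mult_le_0_iff)
      moreover have "r * exp \<xi> - m \<le> 0" using * False by (auto simp: zero_le_mult_iff)
      ultimately show ?thesis by (rule mult_nonpos_nonpos[rotated])
    qed
  qed
  have "0 \<le> (r * exp \<xi> - m) * (exp (lam * z) - 1) / lam" using 2 lam by simp
  also have "\<dots> = r * exp \<xi> * ((exp (lam * z) - 1) / lam) - m / lam * (exp (lam * z) - 1)"
    using lam by (simp add: field_simps)
  finally show ?thesis
    using 1 unfolding trunc_fisher_def z_def \<xi>_def \<xi>'_def by linarith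
qed

text \<open>The truncated maximum is at most the unrestricted one, which is attained at \<open>ln (m / r)\<close>.\<close>

lemma trunc_entropy_le:
  assumes "0 \<le> n" "0 \<le> m" "0 \<le> r" "r = 0 \<Longrightarrow> m = 0"
  shows "trunc_entropy n m r \<le> m * ln (m / r) - m + r"
proof (cases "m = 0")
  case True
  then show ?thesis using assms(3) by (simp add: trunc_entropy_def algebra_simps)
next
  case False
  then have pos: "0 < m" "0 < r" using assms by force+
  define \<eta> \<zeta> where "\<eta> = trunc_log n m r" and "\<zeta> = ln (m / r)"
  have "r * exp \<zeta> = m" using pos by (simp add: \<zeta>_def)
  moreover have "r * exp \<eta> = r * exp \<zeta> * exp (\<eta> - \<zeta>)" by (simp add: exp_diff)
  ultimately have "m * (1 + (\<eta> - \<zeta>)) \<le> r * exp \<eta>"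
    using pos by (simp add: mult_left_mono)
  then show ?thesis
    unfolding trunc_entropy_def \<eta>_def[symmetric] \<zeta>_def[symmetric] by (simp add: algebra_simps)
qed

lemma trunc_log_eventually:
  assumes "0 < m" "0 < r"
  shows "\<forall>\<^sub>F n in sequentially. trunc_log (real n) m r = ln (m / r)"
proof -
  obtain N :: nat where N: "\<bar>ln (m / r)\<bar> < real N" using reals_Archimedean2 by blast
  have "trunc_log (real n) m r = ln (m / r)" if "N \<le> n" for n
  proof -
    have "\<bar>ln (m / r)\<bar> < real n" using N that by simp
    then have "exp (- real n) < exp (ln (m / r))" "exp (ln (m / r)) < exp (real n)"
      unfolding exp_less_cancel_iff by linarith+
    then have "exp (- real n) < m / r" "m / r < exp (real n)" using assms by simp_all
    then show ?thesis
      using assms by (simp add: trunc_log_def field_simps not_le)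
  qed
  then show ?thesis unfolding eventually_sequentially by blast
qed

lemma trunc_log_zero: "0 < r \<Longrightarrow> trunc_log n 0 r = - n"
  by (simp add: trunc_log_def mult_le_0_iff not_le)

lemma exp_trunc_log_tendsto:
  assumes "0 \<le> m" "0 < r"
  shows "(\<lambda>n. exp (trunc_log (real n) m r)) \<longlonglongrightarrow> m / r"
proof (cases "m = 0")
  case True
  have "(\<lambda>n. exp (- real n)) \<longlonglongrightarrow> 0"
    by (intro filterlim_compose[OF exp_at_bot] filterlim_compose[OF filterlim_uminus_at_bot_at_top]
        filterlim_real_sequentially)
  then show ?thesis using True assms by (simp add: trunc_log_zero)
next
  case False
  then have "0 < m" using assms by simp
  show ?thesis
    by (rule tendsto_eventually)
       (use trunc_log_eventually[OF \<open>0 < m\<close> assms(2)] in eventually_elim, use \<open>0 < m\<close> assms in simp)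
qed

lemma trunc_entropy_tendsto:
  assumes "0 \<le> m" "0 < r"
  shows "(\<lambda>n. trunc_entropy (real n) m r) \<longlonglongrightarrow> m * ln (m / r) - m + r"
proof -
  have "(\<lambda>n. m * trunc_log (real n) m r) \<longlonglongrightarrow> m * ln (m / r)"
  proof (cases "m = 0")
    case False
    then have "0 < m" using assms by simp
    show ?thesis
      by (rule tendsto_eventually)
         (use trunc_log_eventually[OF \<open>0 < m\<close> assms(2)] in eventually_elim, simp)
  qed simp
  from tendsto_diff[OF this tendsto_mult[OF tendsto_const[of r] tendsto_diff[OF exp_trunc_log_tendsto[OF assms] tendsto_const[of 1]]]]
  show ?thesis using assms by (simp add: trunc_entropy_def algebra_simps)
qed

lemma trunc_fisher_tendsto:
  assumes "0 \<le> m" "0 < r" "0 \<le> m'" "0 < r'" and lam: "0 < lam" "lam < 1"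
  shows "(\<lambda>n. trunc_fisher lam (real n) m r m' r') \<longlonglongrightarrow>
    m' / r' * r - m - 1 / lam * (m powr (1 - lam) * r powr lam * (m' / r') powr lam - m)"
proof -
  let ?c = "\<lambda>n. exp (trunc_log (real n) m r)" and ?c' = "\<lambda>n. exp (trunc_log (real n) m' r')"
  note c = exp_trunc_log_tendsto[OF assms(1,2)] and c' = exp_trunc_log_tendsto[OF assms(3,4)]
  have "(\<lambda>n. m * exp (lam * (trunc_log (real n) m' r' - trunc_log (real n) m r)))
      \<longlonglongrightarrow> m powr (1 - lam) * r powr lam * (m' / r') powr lam"
  proof (cases "m = 0")
    case False
    then have m: "0 < m" using assms by simp
    have "(\<lambda>n. m * (?c' n powr lam / ?c n powr lam)) \<longlonglongrightarrow> m * ((m' / r') powr lam / (m / r) powr lam)"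
      using m assms lam
      by (intro tendsto_intros tendsto_powr' c c') (auto simp: powr_gt_zero)
    moreover have "?c' n powr lam / ?c n powr lam = exp (lam * (trunc_log (real n) m' r' - trunc_log (real n) m r))" for n
      by (simp add: powr_def right_diff_distrib exp_diff)
    moreover have "m * ((m' / r') powr lam / (m / r) powr lam) = m powr (1 - lam) * r powr lam * (m' / r') powr lam"
      using m assms by (simp add: powr_divide powr_diff mult_ac)
    ultimately show ?thesis by simp
  qed simp
  from tendsto_mult[OF tendsto_const[of "1 / lam"] tendsto_diff[OF this tendsto_const[of m]]]
  have "(\<lambda>n. m / lam * (exp (lam * (trunc_log (real n) m' r' - trunc_log (real n) m r)) - 1))
      \<longlonglongrightarrow> 1 / lam * (m powr (1 - lam) * r powr lam * (m' / r') powr lam - m)"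
    by (simp add: algebra_simps)
  moreover have "(\<lambda>n. r * (?c' n - ?c n)) \<longlonglongrightarrow> r * (m' / r' - m / r)"
    by (intro tendsto_intros c c')
  ultimately have "(\<lambda>n. r * (?c' n - ?c n) - m / lam * (exp (lam * (trunc_log (real n) m' r' - trunc_log (real n) m r)) - 1))
      \<longlonglongrightarrow> r * (m' / r' - m / r) - 1 / lam * (m powr (1 - lam) * r powr lam * (m' / r') powr lam - m)"
    by (intro tendsto_diff)
  moreover have "r * (m' / r' - m / r) = m' / r' * r - m" using assms by (simp add: field_simps)
  ultimately show ?thesis by (simp add: trunc_fisher_def)
qed

lemma trunc_log_measurable [measurable]:
  assumes [measurable]: "f \<in> borel_measurable M" "g \<in> borel_measurable M"
  shows "(\<lambda>t. trunc_log n (f t) (g t)) \<in> borel_measurable M"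
  unfolding trunc_log_def by measurable

lemma trunc_fisher_measurable [measurable]:
  assumes [measurable]: "f \<in> borel_measurable M" "g \<in> borel_measurable M"
    "f' \<in> borel_measurable M" "g' \<in> borel_measurable M"
  shows "(\<lambda>t. trunc_fisher lam n (f t) (g t) (f' t) (g' t)) \<in> borel_measurable M"
  unfolding trunc_fisher_def by measurable

section \<open>Double sums over the rates of a generator\<close>

lemma generator_row_summable: "generator L \<Longrightarrow> L x summable_on UNIV"
  unfolding generator_def using has_sum_imp_summable by blast

lemma generator_row_sum: "generator L \<Longrightarrow> (\<Sum>\<^sub>\<infinity>y. L x y) = 0"
  by (intro infsumI) (simp add: generator_def)

text \<open>In a row of sum zero whose entries off the diagonal are nonnegative, these entries add up to
  minus the diagonal entry.\<close>

lemma generator_row_bounded: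
  assumes L: "generator L"
  shows "\<exists>K. \<forall>x. l1_norm (L x) \<le> K"
proof -
  have pos: "x \<noteq> y \<Longrightarrow> 0 \<le> L x y" for x y
    using L by (simp add: generator_def)
  obtain K where K: "\<And>x. \<bar>L x x\<bar> \<le> K"
    using L unfolding generator_def bdd_above_def by auto
  have "l1_norm (L x) \<le> 2 * K" for x
  proof (rule l1_norm_le_finite_sums[OF generator_row_summable[OF L]])
    fix A :: "'a set" assume A: "finite A"
    have "(\<Sum>y\<in>A. \<bar>L x y\<bar>) \<le> (\<Sum>y\<in>insert x A. \<bar>L x y\<bar>)"
      using A by (intro sum_mono2) auto
    also have "\<dots> = \<bar>L x x\<bar> + (\<Sum>y\<in>A - {x}. \<bar>L x y\<bar>)"
      using A by (simp add: sum.insert_remove)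
    also have "(\<Sum>y\<in>A - {x}. \<bar>L x y\<bar>) = (\<Sum>y\<in>A - {x}. L x y)"
      using pos by (intro sum.cong) auto
    also have "\<dots> = (\<Sum>y\<in>insert x A. L x y) - L x x"
      using A by (simp add: sum.insert_remove)
    also have "(\<Sum>y\<in>insert x A. L x y) \<le> (\<Sum>\<^sub>\<infinity>y. L x y)"
      using A pos by (intro finite_sum_le_infsum generator_row_summable L) auto
    also have "(\<Sum>\<^sub>\<infinity>y. L x y) = 0" by (rule generator_row_sum[OF L])
    finally show "(\<Sum>y\<in>A. \<bar>L x y\<bar>) \<le> 2 * K" using K[of x] by linarith
  qed
  then show ?thesis by blast
qed

lemma generator_weighted_summable:
  fixes L :: "'a::countable \<Rightarrow> 'a \<Rightarrow> real"
  assumes "generator L" and b: "\<And>x y. \<bar>b x y\<bar> \<le> B"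
  shows "(\<lambda>(x, y). L x y * pmf p x * b x y) summable_on UNIV"
proof -
  obtain K where K: "\<And>x. l1_norm (L x) \<le> K"
    using generator_row_bounded[OF assms(1)] by blast
  note L = generator_row_summable[OF assms(1)] K
  have B: "0 \<le> B" using b[of undefined undefined] by linarith
  have eq: "L x y * pmf p x * b x y = (pmf p x * b x y) * L x y" for x y by simp
  have bd: "\<bar>pmf p x * b x y\<bar> \<le> pmf p x * B" for x y
    by (simp add: abs_mult b mult_left_mono)
  have row: "(\<lambda>y. L x y * pmf p x * b x y) summable_on UNIV" for x
    unfolding eq using bd L(1) by (rule bounded_mult_summable)
  have le: "l1_norm (\<lambda>y. L x y * pmf p x * b x y) \<le> B * K * pmf p x" for x
  proof (rule l1_norm_le_finite_sums[OF row])
    fix A :: "'a set" assume A: "finite A"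
    have "(\<Sum>y\<in>A. \<bar>L x y * pmf p x * b x y\<bar>) \<le> (\<Sum>y\<in>A. (pmf p x * B) * \<bar>L x y\<bar>)"
      unfolding eq abs_mult[of _ "L _ _"] using bd by (intro sum_mono mult_right_mono) auto
    also have "\<dots> = pmf p x * B * (\<Sum>y\<in>A. \<bar>L x y\<bar>)" by (simp add: sum_distrib_left)
    also have "\<dots> \<le> pmf p x * B * K"
      using B order_trans[OF sum_abs_le_l1_norm[OF L(1) A] L(2)] by (intro mult_left_mono) auto
    finally show "(\<Sum>y\<in>A. \<bar>L x y * pmf p x * b x y\<bar>) \<le> B * K * pmf p x" by (simp add: mult_ac)
  qed
  have "(\<lambda>x. l1_norm (\<lambda>y. L x y * pmf p x * b x y)) summable_on UNIV"
    by (rule summable_on_comparison_test[OF summable_on_cmult_right[OF pmf_summable[of p], of "B * K"]])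
       (use le l1_norm_nonneg in auto)
  then have "Infinite_Sum.abs_summable_on (\<lambda>(x, y). L x y * pmf p x * b x y) (UNIV \<times> UNIV)"
    using row
    by (subst Infinite_Sum.abs_summable_on_Sigma_iff)
       (auto simp: l1_norm_def abs_summable_iff)
  then show ?thesis by (simp add: abs_summable_summable)
qed

text \<open>Summation over the rows gives zero for the part with \<open>c x\<close>; it is inserted so that the sum over
  pairs has differences as weights, as the Fisher information does.\<close>

lemma generator_double_sum:
  fixes L :: "'a::countable \<Rightarrow> 'a \<Rightarrow> real" and p :: "'a pmf"
  assumes L: "generator L" and c: "\<And>x. \<bar>c x\<bar> \<le> C"
  shows "(\<Sum>\<^sub>\<infinity>y. c y * transpose_gen L (pmf p) y) = (\<Sum>\<^sub>\<infinity>(x, y). L x y * pmf p x * (c y - c x))"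
proof -
  have rows: "(\<Sum>\<^sub>\<infinity>y. L x y) = 0" for x by (rule generator_row_sum[OF L])
  have s1: "(\<lambda>(x, y). L x y * pmf p x * c y) summable_on UNIV"
    and s2: "(\<lambda>(x, y). L x y * pmf p x * c x) summable_on UNIV"
    using generator_weighted_summable[OF L, of "\<lambda>x y. c y" C p]
      generator_weighted_summable[OF L, of "\<lambda>x y. c x" C p] c by auto
  have "(\<Sum>\<^sub>\<infinity>y. c y * transpose_gen L (pmf p) y) = (\<Sum>\<^sub>\<infinity>y. \<Sum>\<^sub>\<infinity>x. L x y * pmf p x * c y)"
    unfolding transpose_gen_def
    by (intro infsum_cong) (simp add: infsum_cmult_left' mult.commute[of "c _"])
  also have "\<dots> = (\<Sum>\<^sub>\<infinity>x. \<Sum>\<^sub>\<infinity>y. L x y * pmf p x * c y)"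
    using s1 by (intro infsum_swap_banach[symmetric]) simp
  also have "\<dots> = (\<Sum>\<^sub>\<infinity>(x, y). L x y * pmf p x * c y)"
    using infsum_Sigma_banach[of "\<lambda>(x, y). L x y * pmf p x * c y" UNIV "\<lambda>_. UNIV"] s1 by simp
  finally have 1: "(\<Sum>\<^sub>\<infinity>y. c y * transpose_gen L (pmf p) y) = (\<Sum>\<^sub>\<infinity>(x, y). L x y * pmf p x * c y)" .
  have "(\<Sum>\<^sub>\<infinity>(x, y). L x y * pmf p x * c x) = (\<Sum>\<^sub>\<infinity>x. \<Sum>\<^sub>\<infinity>y. L x y * pmf p x * c x)"
    using infsum_Sigma_banach[of "\<lambda>(x, y). L x y * pmf p x * c x" UNIV "\<lambda>_. UNIV"] s2 by simp
  also have "\<dots> = 0"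
    by (simp add: infsum_cmult_left' rows)
  finally have 2: "(\<Sum>\<^sub>\<infinity>(x, y). L x y * pmf p x * c x) = 0" .
  have "((\<lambda>z. (case z of (x, y) \<Rightarrow> L x y * pmf p x * c y) + - (case z of (x, y) \<Rightarrow> L x y * pmf p x * c x))
      has_sum ((\<Sum>\<^sub>\<infinity>(x, y). L x y * pmf p x * c y) + - 0)) UNIV"
    using s1 s2 2 by (intro has_sum_add has_sum_minusI) (auto simp: has_sum_iff)
  then have "(\<Sum>\<^sub>\<infinity>(x, y). L x y * pmf p x * (c y - c x)) = (\<Sum>\<^sub>\<infinity>(x, y). L x y * pmf p x * c y)"
    by (intro infsumI) (simp add: case_prod_unfold algebra_simps)
  then show ?thesis using 1 by simp
qed

definition trunc_fisher_sum ::
  "('a::countable \<Rightarrow> 'a \<Rightarrow> real) \<Rightarrow> real \<Rightarrow> real \<Rightarrow> 'a pmf \<Rightarrow> 'a pmf \<Rightarrow> real" where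
  "trunc_fisher_sum L lam n \<mu> \<rho> =
     (\<Sum>\<^sub>\<infinity>(x, y). L x y * trunc_fisher lam n (pmf \<mu> x) (pmf \<rho> x) (pmf \<mu> y) (pmf \<rho> y))"

text \<open>Here the Fisher information arises: on the right are the contribution of the forward equation to
  the time derivative of the entropy, with opposite sign, and the Hamiltonian of the test function.
  By \<open>generator_double_sum\<close> both are sums over pairs of states, and they are added summand by
  summand.\<close>

lemma
  fixes L :: "'a::countable \<Rightarrow> 'a \<Rightarrow> real" and \<mu> \<rho> :: "'a pmf"
  defines "\<xi> \<equiv> \<lambda>n x. trunc_log n (pmf \<mu> x) (pmf \<rho> x)"
  assumes L: "generator L" and lam: "0 < lam" and n: "0 \<le> n"
  shows trunc_fisher_summable:
      "(\<lambda>(x, y). L x y * trunc_fisher lam n (pmf \<mu> x) (pmf \<rho> x) (pmf \<mu> y) (pmf \<rho> y)) summable_on UNIV"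
    and trunc_fisher_sum_eq:
      "trunc_fisher_sum L lam n \<mu> \<rho> =
        (\<Sum>\<^sub>\<infinity>x. (exp (\<xi> n x) - 1) * transpose_gen L (pmf \<rho>) x)
          - 1 / lam * hamiltonian L \<mu> (\<lambda>x. lam * \<xi> n x)"
proof -
  define c where "c x = exp (\<xi> n x) - 1" for x
  define b where "b x y = exp (lam * (\<xi> n y - \<xi> n x)) - 1" for x y
  have \<xi>: "- n \<le> \<xi> n x" "\<xi> n x \<le> n" for x
    unfolding \<xi>_def using n by (simp_all add: trunc_log_bounds)
  have c: "\<bar>c x\<bar> \<le> exp n" for x unfolding c_def using \<xi> n by (intro exp_minus_one_bound) auto
  have cc: "\<bar>c y - c x\<bar> \<le> 2 * exp n" for x y using c[of x] c[of y] by linarith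
  have b: "\<bar>b x y\<bar> \<le> exp (lam * (2 * n))" for x y
    unfolding b_def
  proof (rule exp_minus_one_bound)
    have "\<bar>\<xi> n y - \<xi> n x\<bar> \<le> 2 * n" using \<xi>[of x] \<xi>[of y] by linarith
    then have "\<bar>lam * (\<xi> n y - \<xi> n x)\<bar> \<le> lam * (2 * n)"
      using lam by (simp add: abs_mult)
    then show "- (lam * (2 * n)) \<le> lam * (\<xi> n y - \<xi> n x)" "lam * (\<xi> n y - \<xi> n x) \<le> lam * (2 * n)"
      by linarith+
  qed (use lam n in simp)
  have s1: "(\<lambda>(x, y). L x y * pmf \<rho> x * (c y - c x)) summable_on UNIV"
    and s2: "(\<lambda>(x, y). L x y * pmf \<mu> x * b x y) summable_on UNIV"
    using generator_weighted_summable[OF L cc] generator_weighted_summable[OF L b] by auto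
  have "hamiltonian L \<mu> (\<lambda>x. lam * \<xi> n x) = (\<Sum>\<^sub>\<infinity>(x, y). L x y * pmf \<mu> x * b x y)"
    unfolding hamiltonian_def b_def by (intro infsum_cong) (auto simp: algebra_simps)
  with s2 have h2: "((\<lambda>(x, y). L x y * pmf \<mu> x * b x y) has_sum hamiltonian L \<mu> (\<lambda>x. lam * \<xi> n x)) UNIV"
    by (simp add: has_sum_iff)
  have h1: "((\<lambda>(x, y). L x y * pmf \<rho> x * (c y - c x)) has_sum (\<Sum>\<^sub>\<infinity>x. c x * transpose_gen L (pmf \<rho>) x)) UNIV"
    using s1 generator_double_sum[OF L c] by (simp add: has_sum_iff)
  have "((\<lambda>z. (case z of (x, y) \<Rightarrow> L x y * pmf \<rho> x * (c y - c x))
        + (- (1 / lam)) * (case z of (x, y) \<Rightarrow> L x y * pmf \<mu> x * b x y))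
      has_sum ((\<Sum>\<^sub>\<infinity>x. c x * transpose_gen L (pmf \<rho>) x) + (- (1 / lam)) * hamiltonian L \<mu> (\<lambda>x. lam * \<xi> n x))) UNIV"
    by (intro has_sum_add has_sum_cmult_right h1 h2)
  moreover have "(\<lambda>z. (case z of (x, y) \<Rightarrow> L x y * pmf \<rho> x * (c y - c x))
        + (- (1 / lam)) * (case z of (x, y) \<Rightarrow> L x y * pmf \<mu> x * b x y))
    = (\<lambda>(x, y). L x y * trunc_fisher lam n (pmf \<mu> x) (pmf \<rho> x) (pmf \<mu> y) (pmf \<rho> y))"
    by (auto simp: fun_eq_iff trunc_fisher_def c_def b_def \<xi>_def algebra_simps diff_divide_distrib)
  ultimately have *: "((\<lambda>(x, y). L x y * trunc_fisher lam n (pmf \<mu> x) (pmf \<rho> x) (pmf \<mu> y) (pmf \<rho> y))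
      has_sum ((\<Sum>\<^sub>\<infinity>x. c x * transpose_gen L (pmf \<rho>) x) + (- (1 / lam)) * hamiltonian L \<mu> (\<lambda>x. lam * \<xi> n x))) UNIV"
    by simp
  then show "(\<lambda>(x, y). L x y * trunc_fisher lam n (pmf \<mu> x) (pmf \<rho> x) (pmf \<mu> y) (pmf \<rho> y)) summable_on UNIV"
    by (rule has_sum_imp_summable)
  show "trunc_fisher_sum L lam n \<mu> \<rho> =
        (\<Sum>\<^sub>\<infinity>x. (exp (\<xi> n x) - 1) * transpose_gen L (pmf \<rho>) x)
          - 1 / lam * hamiltonian L \<mu> (\<lambda>x. lam * \<xi> n x)"
    using infsumI[OF *] by (simp add: trunc_fisher_sum_def c_def)
qed

text \<open>The diagonal entries of \<open>L\<close> are not positive, but they multiply \<open>trunc_fisher\<close> at equal states,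
  which is zero.\<close>

lemma trunc_fisher_term_nonneg:
  assumes L: "generator L" and lam: "0 < lam" "lam < 1" and n: "0 \<le> n"
  shows "0 \<le> L x y * trunc_fisher lam n (pmf \<mu> x) (pmf \<rho> x) (pmf \<mu> y) (pmf \<rho> y)"
proof (cases "x = y")
  case False
  then have "0 \<le> L x y" using L by (simp add: generator_def)
  then show ?thesis using lam n by (intro mult_nonneg_nonneg trunc_fisher_nonneg) auto
qed (simp add: trunc_fisher_def)

section \<open>Truncated entropy and Fisher information of measures\<close>

definition trunc_entropy_sum :: "real \<Rightarrow> 'a pmf \<Rightarrow> 'a pmf \<Rightarrow> real" where
  "trunc_entropy_sum n \<mu> \<rho> = (\<Sum>\<^sub>\<infinity>x. trunc_entropy n (pmf \<mu> x) (pmf \<rho> x))"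

lemma trunc_entropy_summable:
  assumes "0 \<le> n"
  shows "(\<lambda>x. trunc_entropy n (pmf \<mu> x) (pmf \<rho> x)) summable_on UNIV"
proof (rule summable_on_comparison_test)
  show "(\<lambda>x. n * pmf \<mu> x + exp n * pmf \<rho> x) summable_on UNIV"
    by (intro summable_on_add summable_on_cmult_right pmf_summable)
  show "0 \<le> trunc_entropy n (pmf \<mu> x) (pmf \<rho> x)" for x
    using assms by (simp add: trunc_entropy_nonneg)
  show "trunc_entropy n (pmf \<mu> x) (pmf \<rho> x) \<le> n * pmf \<mu> x + exp n * pmf \<rho> x" for x
    using trunc_entropy_lipschitz[of n 0 0 "pmf \<mu> x" "pmf \<rho> x"] assms
    by (simp add: trunc_entropy_def)
qed

lemma trunc_entropy_sum_lipschitz: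
  assumes n: "0 \<le> n"
  shows "\<bar>trunc_entropy_sum n \<mu>' \<rho>' - trunc_entropy_sum n \<mu> \<rho>\<bar> \<le> n * l1_dist \<mu>' \<mu> + exp n * l1_dist \<rho>' \<rho>"
proof -
  let ?d = "\<lambda>x. trunc_entropy n (pmf \<mu>' x) (pmf \<rho>' x) - trunc_entropy n (pmf \<mu> x) (pmf \<rho> x)"
  note d = infsum_diff_real[OF trunc_entropy_summable[OF n, of \<mu>' \<rho>'] trunc_entropy_summable[OF n, of \<mu> \<rho>]]
  have "((\<lambda>x. n * \<bar>pmf \<mu>' x - pmf \<mu> x\<bar> + exp n * \<bar>pmf \<rho>' x - pmf \<rho> x\<bar>)
      has_sum (n * l1_dist \<mu>' \<mu> + exp n * l1_dist \<rho>' \<rho>)) UNIV"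
    unfolding l1_dist_def l1_norm_def
    by (intro has_sum_add has_sum_cmult_right has_sum_infsum) (simp_all add: abs_summable_iff pmf_diff_summable)
  then have "norm (infsum ?d UNIV) \<le> n * l1_dist \<mu>' \<mu> + exp n * l1_dist \<rho>' \<rho>"
    by (rule norm_infsum_le[OF has_sum_infsum[OF d(2)]]) (simp add: trunc_entropy_lipschitz n)
  then show ?thesis by (simp add: d(1) trunc_entropy_sum_def)
qed

lemma interior_minimum_derivative_zero:
  fixes f :: "real \<Rightarrow> real"
  assumes "(f has_real_derivative D) (at t within {0..T})" "0 < t" "t < T" "\<And>s. f t \<le> f s"
  shows "D = 0"
proof (rule DERIV_local_min)
  show "(f has_real_derivative D) (at t)" using assms(1-3) by (simp add: at_within_Icc_at)
qed (use assms in \<open>auto intro: zero_less_one\<close>)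

text \<open>The function \<open>\<Phi>\<close> obtained by subtracting from the entropy at time \<open>s\<close> its linearisation at time
  \<open>t\<close> has a global minimum at \<open>s = t\<close>, by convexity. Its derivative there is zero, and the
  linear terms are differentiable because the curves are.\<close>

lemma trunc_entropy_sum_derivative:
  fixes \<mu> \<rho> :: "real \<Rightarrow> 'a pmf" and n t :: real
  defines "\<xi> \<equiv> \<lambda>x. trunc_log n (pmf (\<mu> t) x) (pmf (\<rho> t) x)"
  assumes n: "0 \<le> n" and t: "0 < t" "t < T"
    and v: "has_l1_deriv T \<mu> v t" and w: "has_l1_deriv T \<rho> w t"
    and D: "((\<lambda>s. trunc_entropy_sum n (\<mu> s) (\<rho> s)) has_real_derivative D) (at t within {0..T})"
  shows "D = (\<Sum>\<^sub>\<infinity>x. \<xi> x * v x) - (\<Sum>\<^sub>\<infinity>x. (exp (\<xi> x) - 1) * w x)"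
proof -
  have \<xi>: "- n \<le> \<xi> x" "\<xi> x \<le> n" for x unfolding \<xi>_def using n by (simp_all add: trunc_log_bounds)
  have \<xi>': "\<bar>\<xi> x\<bar> \<le> n" for x using \<xi>[of x] by linarith
  have c: "\<bar>exp (\<xi> x) - 1\<bar> \<le> exp n" for x using \<xi> n by (intro exp_minus_one_bound) auto
  define \<Phi> where "\<Phi> s = trunc_entropy_sum n (\<mu> s) (\<rho> s) - (\<Sum>\<^sub>\<infinity>x. \<xi> x * pmf (\<mu> s) x)
      + (\<Sum>\<^sub>\<infinity>x. (exp (\<xi> x) - 1) * pmf (\<rho> s) x)" for s
  have deriv: "(\<Phi> has_real_derivative D - (\<Sum>\<^sub>\<infinity>x. \<xi> x * v x) + (\<Sum>\<^sub>\<infinity>x. (exp (\<xi> x) - 1) * w x)) (at t within {0..T})"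
    unfolding \<Phi>_def
    by (intro derivative_intros D has_l1_deriv_weighted[OF v \<xi>'] has_l1_deriv_weighted[OF w c])
  have "((\<lambda>x. trunc_entropy n (pmf (\<mu> s) x) (pmf (\<rho> s) x) + (- (\<xi> x * pmf (\<mu> s) x))
      + (exp (\<xi> x) - 1) * pmf (\<rho> s) x) has_sum
      (trunc_entropy_sum n (\<mu> s) (\<rho> s) + (- (\<Sum>\<^sub>\<infinity>x. \<xi> x * pmf (\<mu> s) x))
      + (\<Sum>\<^sub>\<infinity>x. (exp (\<xi> x) - 1) * pmf (\<rho> s) x))) UNIV" for s
    unfolding trunc_entropy_sum_def
    by (intro has_sum_add has_sum_minusI has_sum_infsum trunc_entropy_summable[OF n]
        bounded_mult_summable(1)[OF \<xi>' pmf_summable] bounded_mult_summable(1)[OF c pmf_summable])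
  then have \<Phi>: "((\<lambda>x. trunc_entropy n (pmf (\<mu> s) x) (pmf (\<rho> s) x) + (- (\<xi> x * pmf (\<mu> s) x))
      + (exp (\<xi> x) - 1) * pmf (\<rho> s) x) has_sum \<Phi> s) UNIV" for s
    by (simp add: \<Phi>_def)
  have "\<Phi> t \<le> \<Phi> s" for s
  proof (rule has_sum_mono[OF \<Phi> \<Phi>])
    fix x
    show "trunc_entropy n (pmf (\<mu> t) x) (pmf (\<rho> t) x) + (- (\<xi> x * pmf (\<mu> t) x)) + (exp (\<xi> x) - 1) * pmf (\<rho> t) x
        \<le> trunc_entropy n (pmf (\<mu> s) x) (pmf (\<rho> s) x) + (- (\<xi> x * pmf (\<mu> s) x)) + (exp (\<xi> x) - 1) * pmf (\<rho> s) x"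
      using trunc_entropy_subgradient[OF n, of "pmf (\<mu> t) x" "pmf (\<rho> t) x" "pmf (\<mu> s) x" "pmf (\<rho> s) x"]
      by (simp add: \<xi>_def algebra_simps)
  qed
  from interior_minimum_derivative_zero[OF deriv t this] show ?thesis by simp
qed

text \<open>The nonnegative function \<open>s \<mapsto> \<rho>\<^sub>s(y)\<close> has a minimum at \<open>t\<close>, so \<open>(L\<^sup>T \<rho>\<^sub>t)(y) = 0\<close>. All summands of
  this sum are nonnegative, hence zero.\<close>

lemma forward_equation_vanishing:
  assumes L: "generator L" and t: "0 < t" "t < T"
    and \<rho>: "has_l1_deriv T \<rho> (transpose_gen L (pmf (\<rho> t))) t"
    and y: "pmf (\<rho> t) y = 0" and "x \<noteq> y"
  shows "L x y * pmf (\<rho> t) x = 0"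
proof -
  have zero: "transpose_gen L (pmf (\<rho> t)) y = 0"
    by (rule interior_minimum_derivative_zero[OF has_l1_deriv_coordinate[OF \<rho>, of y] t]) (simp add: y)
  obtain K where K: "\<And>x. l1_norm (L x) \<le> K" using generator_row_bounded[OF L] by blast
  have bound: "\<bar>L x y\<bar> \<le> K" for x
    using abs_le_l1_norm[OF generator_row_summable[OF L]] K by (rule order_trans)
  have "(\<lambda>x. L x y * pmf (\<rho> t) x) summable_on UNIV"
    by (rule bounded_mult_summable(1)[OF bound pmf_summable])
  moreover have "0 \<le> L z y * pmf (\<rho> t) z" for z
    using L y by (cases "z = y") (auto simp: generator_def)
  ultimately show ?thesis
    using zero unfolding transpose_gen_def
    by (intro nonneg_infsum_le_0D[of "\<lambda>x. L x y * pmf (\<rho> t) x" UNIV]) auto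
qed

text \<open>Fatou's lemma for the sum over pairs of states. On pairs with \<open>\<rho>(x), \<rho>(y) > 0\<close> the truncated
  summands converge to those of the Fisher information. On all other pairs the summand of the
  Fisher information is zero; in the case of infinite \<open>\<psi>\<^sub>\<lambda>\<close> this is the hypothesis on the rates.\<close>

lemma fisher_info_le_liminf:
  fixes L :: "'a::countable \<Rightarrow> 'a \<Rightarrow> real"
  assumes L: "generator L" and lam: "0 < lam" "lam < 1"
    and vanish: "\<And>x y. x \<noteq> y \<Longrightarrow> pmf \<rho> y = 0 \<Longrightarrow> L x y * pmf \<rho> x = 0"
  shows "e2ennreal (fisher_info L lam \<mu> \<rho>) \<le> liminf (\<lambda>k. ennreal (trunc_fisher_sum L lam (real k) \<mu> \<rho>))"
    (is "_ \<le> ?B")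
proof -
  define g where "g = (\<lambda>(x, y). ereal (L x y) * fisher_psi lam \<mu> \<rho> x y)"
  define good where "good = {(x, y). 0 < pmf \<rho> x \<and> 0 < pmf \<rho> y}"
  define h where "h = (\<lambda>(x, y). L x y * (pmf \<mu> y / pmf \<rho> y * pmf \<rho> x - pmf \<mu> x
          - 1 / lam * (pmf \<mu> x powr (1 - lam) * pmf \<rho> x powr lam
                         * (pmf \<mu> y / pmf \<rho> y) powr lam - pmf \<mu> x)))"
  define tn where "tn k = (\<lambda>(x, y). L x y * trunc_fisher lam (real k) (pmf \<mu> x) (pmf \<rho> x) (pmf \<mu> y) (pmf \<rho> y))" for k :: nat
  have tn_nonneg: "0 \<le> tn k z" for k z
    using trunc_fisher_term_nonneg[OF L lam] by (auto simp: tn_def split: prod.split)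
  have g_good: "g z = ereal (h z)" if "z \<in> good" for z
    using that by (auto simp: g_def h_def good_def fisher_psi_def)
  have g_bad: "g z = 0" if "z \<notin> good" for z
  proof -
    obtain x y where z: "z = (x, y)" by fastforce
    have "L x y = 0" if "pmf \<rho> y = 0" "pmf \<rho> x > 0"
      using vanish[of x y] that by (cases "x = y") auto
    then show ?thesis
      using that pmf_pos[of \<rho> x] pmf_pos[of \<rho> y] by (auto simp: z g_def good_def fisher_psi_def zero_ereal_def)
  qed
  have tn_lim: "(\<lambda>k. tn k z) \<longlonglongrightarrow> h z" if "z \<in> good" for z
  proof -
    obtain x y where z: "z = (x, y)" "0 < pmf \<rho> x" "0 < pmf \<rho> y"
      using \<open>z \<in> good\<close> by (auto simp: good_def)
    show ?thesis
      unfolding z(1) tn_def h_def prod.case using z lam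
      by (intro tendsto_mult_left trunc_fisher_tendsto) auto
  qed
  have h_nonneg: "0 \<le> h z" if "z \<in> good" for z
    by (rule LIMSEQ_le_const[OF tn_lim[OF that]]) (use tn_nonneg in blast)
  have g_nonneg: "0 \<le> g z" for z
    using g_good[of z] g_bad[of z] h_nonneg[of z] by (cases "z \<in> good") auto
  have "sum g A \<le> enn2ereal ?B" if A: "finite A" for A
  proof -
    have "ennreal (sum h (A \<inter> good)) \<le> ?B"
    proof -
      have "(\<lambda>k. ennreal (sum (tn k) (A \<inter> good))) \<longlonglongrightarrow> ennreal (sum h (A \<inter> good))"
        by (intro tendsto_ennrealI tendsto_sum tn_lim) auto
      then have "ennreal (sum h (A \<inter> good)) = liminf (\<lambda>k. ennreal (sum (tn k) (A \<inter> good)))"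
        by (rule lim_imp_Liminf[OF sequentially_bot, symmetric])
      also have "\<dots> \<le> ?B"
      proof (rule Liminf_mono, rule always_eventually, rule allI, rule ennreal_leI)
        fix k :: nat
        show "sum (tn k) (A \<inter> good) \<le> trunc_fisher_sum L lam (real k) \<mu> \<rho>"
          unfolding trunc_fisher_sum_def tn_def[symmetric]
          using A tn_nonneg trunc_fisher_summable[OF L lam(1), of "real k" \<mu> \<rho>]
          by (intro finite_sum_le_infsum) (auto simp: tn_def)
      qed
      finally show ?thesis .
    qed
    moreover have "sum g A = ereal (sum h (A \<inter> good))"
    proof -
      have "sum g A = sum g (A \<inter> good)"
        using A g_bad by (intro sum.mono_neutral_right) auto
      also have "\<dots> = (\<Sum>z\<in>A \<inter> good. ereal (h z))" using g_good by (intro sum.cong) auto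
      finally show ?thesis by simp
    qed
    moreover have "0 \<le> sum h (A \<inter> good)" using h_nonneg by (intro sum_nonneg) auto
    ultimately show ?thesis
      by (metis enn2ereal_ennreal less_eq_ennreal.rep_eq)
  qed
  then have "infsum g UNIV \<le> enn2ereal ?B"
    using g_nonneg by (intro infsum_le_finite_sums nonneg_summable_on_complete) auto
  then have "e2ennreal (infsum g UNIV) \<le> e2ennreal (enn2ereal ?B)" by (rule e2ennreal_mono)
  then show ?thesis by (simp add: fisher_info_def g_def)
qed

text \<open>A finite relative entropy is a convergent sum of terms \<open>m ln (m / r)\<close>, the form in which they occur
  in the limit of the truncated entropy.\<close>

lemma rel_entropy_real_cases:
  obtains H where "rel_entropy \<mu> \<rho> = ereal H" "\<forall>x. pmf \<rho> x = 0 \<longrightarrow> pmf \<mu> x = 0"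
    "((\<lambda>x. pmf \<mu> x * ln (pmf \<mu> x / pmf \<rho> x)) has_sum H) UNIV"
  | "rel_entropy \<mu> \<rho> = \<infinity>"
proof (cases "(\<forall>x. pmf \<rho> x = 0 \<longrightarrow> pmf \<mu> x = 0) \<and>
    (\<lambda>x. let f = pmf \<mu> x / pmf \<rho> x in f * ln f * pmf \<rho> x) summable_on UNIV")
  case True
  have "(let f = pmf \<mu> x / pmf \<rho> x in f * ln f * pmf \<rho> x) = pmf \<mu> x * ln (pmf \<mu> x / pmf \<rho> x)" for x
    using True by (cases "pmf \<rho> x = 0") (auto simp: Let_def)
  then show thesis
    using that(1) True rel_entropy_summable[of \<rho> \<mu>] by (simp add: has_sum_iff)
next
  case False
  have "rel_entropy \<mu> \<rho> = \<infinity>"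
  proof (cases "\<forall>x. pmf \<rho> x = 0 \<longrightarrow> pmf \<mu> x = 0")
    case True
    with False show ?thesis by (intro rel_entropy_not_summable) simp
  qed (simp only: rel_entropy_def if_False)
  then show thesis by (rule that(2))
qed

text \<open>The extra terms \<open>- m + r\<close> in the bound of the truncated entropy cancel in the sum, since both
  measures have mass one; they also cancel in the converse estimate below.\<close>

lemma trunc_entropy_sum_le:
  assumes H: "rel_entropy \<mu> \<rho> = ereal H" and n: "0 \<le> n"
  shows "trunc_entropy_sum n \<mu> \<rho> \<le> H"
proof (cases rule: rel_entropy_real_cases[of \<mu> \<rho>])
  case (1 H')
  have "((\<lambda>x. pmf \<mu> x * ln (pmf \<mu> x / pmf \<rho> x) + - pmf \<mu> x + pmf \<rho> x) has_sum (H' + - 1 + 1)) UNIV"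
    by (intro has_sum_add has_sum_minusI 1 pmf_has_sum)
  from has_sum_mono[OF has_sum_infsum[OF trunc_entropy_summable[OF n, of \<mu> \<rho>]] this]
  show ?thesis
    using trunc_entropy_le[OF n] 1 H by (simp add: trunc_entropy_sum_def)
qed (use H in simp)

lemma rel_entropy_le:
  assumes ac: "\<forall>x. pmf \<rho> x = 0 \<longrightarrow> pmf \<mu> x = 0"
    and le: "\<And>A. finite A \<Longrightarrow> (\<Sum>x\<in>A. pmf \<mu> x * ln (pmf \<mu> x / pmf \<rho> x) - pmf \<mu> x + pmf \<rho> x) \<le> c"
  shows "rel_entropy \<mu> \<rho> \<le> ereal c"
proof -
  define h where "h x = pmf \<mu> x * ln (pmf \<mu> x / pmf \<rho> x) - pmf \<mu> x + pmf \<rho> x" for x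
  have nonneg: "0 \<le> h x" for x
    using trunc_entropy_le[of 0 "pmf \<mu> x" "pmf \<rho> x"] trunc_entropy_nonneg[of 0 "pmf \<mu> x" "pmf \<rho> x"] ac
    by (simp add: h_def)
  have summ: "h summable_on UNIV"
    using nonneg le by (intro nonneg_bdd_above_summable_on) (auto intro!: bdd_aboveI[of _ c] simp: h_def)
  have "infsum h UNIV \<le> c"
    using le by (intro infsum_le_finite_sums summ) (auto simp: h_def)
  have "((\<lambda>x. h x + pmf \<mu> x + - pmf \<rho> x) has_sum (infsum h UNIV + 1 + - 1)) UNIV"
    by (intro has_sum_add has_sum_minusI has_sum_infsum summ pmf_has_sum)
  moreover have "h x + pmf \<mu> x + - pmf \<rho> x = (let f = pmf \<mu> x / pmf \<rho> x in f * ln f * pmf \<rho> x)" for x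
    using ac by (cases "pmf \<rho> x = 0") (auto simp: Let_def h_def)
  ultimately have "((\<lambda>x. let f = pmf \<mu> x / pmf \<rho> x in f * ln f * pmf \<rho> x) has_sum infsum h UNIV) UNIV"
    by simp
  then show ?thesis
    using rel_entropy_summable[of \<rho> \<mu>] ac \<open>infsum h UNIV \<le> c\<close> by (simp add: has_sum_iff)
qed

section \<open>The inequality along a curve\<close>

lemma ac_distance_add:
  assumes "ac_distance T d1" "ac_distance T d2"
  shows "ac_distance T (\<lambda>u v. d1 u v + d2 u v)"
  unfolding ac_distance_def
proof (intro allI impI)
  fix e :: real assume "e > 0"
  then have "e / 2 > 0" by simp
  obtain a where a: "a > 0"
    "\<And>I. nonoverlapping 0 T I \<Longrightarrow> (\<Sum>(u, v)\<in>I. v - u) < a \<Longrightarrow> (\<Sum>(u, v)\<in>I. d1 u v) < e / 2"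
    using assms(1) \<open>e / 2 > 0\<close> unfolding ac_distance_def by blast
  obtain b where b: "b > 0"
    "\<And>I. nonoverlapping 0 T I \<Longrightarrow> (\<Sum>(u, v)\<in>I. v - u) < b \<Longrightarrow> (\<Sum>(u, v)\<in>I. d2 u v) < e / 2"
    using assms(2) \<open>e / 2 > 0\<close> unfolding ac_distance_def by blast
  show "\<exists>\<delta>>0. \<forall>I. nonoverlapping 0 T I \<and> (\<Sum>(u, v)\<in>I. v - u) < \<delta> \<longrightarrow> (\<Sum>(u, v)\<in>I. d1 u v + d2 u v) < e"
  proof (intro exI[of _ "min a b"] conjI allI impI)
    fix I assume "nonoverlapping 0 T I \<and> (\<Sum>(u, v)\<in>I. v - u) < min a b"
    then have "(\<Sum>(u, v)\<in>I. d1 u v) < e / 2" "(\<Sum>(u, v)\<in>I. d2 u v) < e / 2"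
      using a(2)[of I] b(2)[of I] by auto
    moreover have "(\<Sum>(u, v)\<in>I. d1 u v + d2 u v) = (\<Sum>(u, v)\<in>I. d1 u v) + (\<Sum>(u, v)\<in>I. d2 u v)"
      by (simp only: case_prod_unfold sum.distrib)
    ultimately show "(\<Sum>(u, v)\<in>I. d1 u v + d2 u v) < e" by linarith
  qed (use a(1) b(1) in simp)
qed

lemma ac_curve_pmf_measurable:
  assumes "ac_curve T p" "0 < T"
  shows "(\<lambda>t. pmf (p (max 0 (min T t))) x) \<in> borel_measurable borel"
proof -
  have "\<bar>pmf (p v) x - pmf (p u) x\<bar> \<le> l1_dist (p v) (p u)" for u v
    unfolding l1_dist_def by (rule abs_le_l1_norm[OF pmf_diff_summable])
  then have "continuous_on {0..T} (\<lambda>t. pmf (p t) x)"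
    by (intro ac_distance_continuous_on[OF ac_curve_imp_ac_distance[OF assms(1)]])
  moreover have "continuous_on UNIV (\<lambda>t. max 0 (min T t))" by (intro continuous_intros)
  ultimately have "continuous_on UNIV (\<lambda>t. pmf (p (max 0 (min T t))) x)"
    by (rule continuous_on_compose2) (use assms(2) in auto)
  then show ?thesis by (rule borel_measurable_continuous_onI)
qed

text \<open>Clamping time to \<open>[0, T]\<close> extends the curves continuously to the real line.\<close>

lemma trunc_fisher_sum_measurable:
  fixes L :: "'a::countable \<Rightarrow> 'a \<Rightarrow> real"
  assumes L: "generator L" and lam: "0 < lam" "lam < 1" and n: "0 \<le> n" and T: "0 < T"
    and \<mu>: "ac_curve T \<mu>" and \<rho>: "ac_curve T \<rho>"
  shows "(\<lambda>t. trunc_fisher_sum L lam n (\<mu> (max 0 (min T t))) (\<rho> (max 0 (min T t)))) \<in> borel_measurable borel"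
proof -
  define cl where "cl t = max 0 (min T t)" for t
  define f where "f = (\<lambda>(x, y) t. L x y *
    trunc_fisher lam n (pmf (\<mu> (cl t)) x) (pmf (\<rho> (cl t)) x) (pmf (\<mu> (cl t)) y) (pmf (\<rho> (cl t)) y))"
  have [measurable]: "(\<lambda>t. pmf (\<mu> (cl t)) x) \<in> borel_measurable borel"
    "(\<lambda>t. pmf (\<rho> (cl t)) x) \<in> borel_measurable borel" for x
    unfolding cl_def
    by (rule ac_curve_pmf_measurable[OF \<mu> T] ac_curve_pmf_measurable[OF \<rho> T])+
  have "f z \<in> borel_measurable borel" for z
    unfolding f_def by (cases z) simp
  then have "finite_sums_sup f \<in> borel_measurable borel" by (rule finite_sums_sup_measurable)
  then have "(\<lambda>t. enn2real (finite_sums_sup f t)) \<in> borel_measurable borel" by measurable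
  moreover have "enn2real (finite_sums_sup f t) = trunc_fisher_sum L lam n (\<mu> (cl t)) (\<rho> (cl t))" for t
  proof -
    have f: "0 \<le> f z t" for z
      using trunc_fisher_term_nonneg[OF L lam n] by (auto simp: f_def split: prod.split)
    have eq: "(\<lambda>z. f z t) = (\<lambda>(x, y). L x y *
        trunc_fisher lam n (pmf (\<mu> (cl t)) x) (pmf (\<rho> (cl t)) x) (pmf (\<mu> (cl t)) y) (pmf (\<rho> (cl t)) y))"
      by (auto simp: f_def)
    have summ: "(\<lambda>z. f z t) summable_on UNIV"
      unfolding eq by (rule trunc_fisher_summable[OF L lam(1) n])
    show ?thesis
      unfolding finite_sums_sup_eq[of f, OF f summ] trunc_fisher_sum_def eq[symmetric]
      using f by (simp add: infsum_nonneg)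
  qed
  ultimately show ?thesis by (simp add: cl_def)
qed

text \<open>The test function is \<open>\<lambda> \<xi>\<close>. The left-hand side is \<open>\<lambda>\<close> times the sum of the time derivative of the
  truncated entropy, as computed in \<open>trunc_entropy_sum_derivative\<close>, and the truncated Fisher
  information.\<close>

lemma lagrangian_trunc_log_ge:
  fixes \<mu> \<rho> :: "'a::countable pmf" and n lam :: real
  defines "\<xi> \<equiv> \<lambda>x. trunc_log n (pmf \<mu> x) (pmf \<rho> x)"
  assumes L: "generator L" and lam: "0 < lam" and n: "0 \<le> n"
  shows "ereal (lam * ((\<Sum>\<^sub>\<infinity>x. \<xi> x * v x) - (\<Sum>\<^sub>\<infinity>x. (exp (\<xi> x) - 1) * transpose_gen L (pmf \<rho>) x)
      + trunc_fisher_sum L lam n \<mu> \<rho>)) \<le> lagrangian L \<mu> v"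
proof -
  have "\<bar>lam * \<xi> x\<bar> \<le> lam * n" for x
    using trunc_log_bounds[of n "pmf \<mu> x" "pmf \<rho> x"] n lam
    by (simp add: abs_mult \<xi>_def abs_le_iff)
  then have "bounded (range (\<lambda>x. lam * \<xi> x))"
    by (auto simp: bounded_iff)
  then have "ereal ((\<Sum>\<^sub>\<infinity>x. lam * \<xi> x * v x) - hamiltonian L \<mu> (\<lambda>x. lam * \<xi> x)) \<le> lagrangian L \<mu> v"
    unfolding lagrangian_def by (intro SUP_upper) simp
  moreover have "(\<Sum>\<^sub>\<infinity>x. lam * \<xi> x * v x) = lam * (\<Sum>\<^sub>\<infinity>x. \<xi> x * v x)"
    by (simp add: mult.assoc infsum_cmult_right')
  moreover define C where "C = (\<Sum>\<^sub>\<infinity>x. (exp (\<xi> x) - 1) * transpose_gen L (pmf \<rho>) x)"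
  moreover have "trunc_fisher_sum L lam n \<mu> \<rho> = C - 1 / lam * hamiltonian L \<mu> (\<lambda>x. lam * \<xi> x)"
    unfolding C_def \<xi>_def by (rule trunc_fisher_sum_eq[OF L lam n])
  ultimately show ?thesis
    using lam by (simp add: distrib_left right_diff_distrib)
qed

text \<open>The entropy inequality for fixed \<open>n\<close>: the pointwise bound on the Lagrangian, integrated in time.
  The bound on the entropy at time \<open>T\<close> is stated separately since the conversion of the right-hand
  side of the second estimate to an extended nonnegative number truncates at zero.\<close>

lemma trunc_inequality:
  fixes L :: "'a::countable \<Rightarrow> 'a \<Rightarrow> real" and \<mu> \<rho> :: "real \<Rightarrow> 'a pmf"
  assumes T: "0 < T" and L: "generator L" and \<rho>: "forward_solution L T \<rho>" and \<mu>: "ac_curve T \<mu>"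
    and lam: "0 < lam" "lam < 1" and n: "0 \<le> n"
    and I: "(\<integral>\<^sup>+t\<in>{0..T}. e2ennreal (lagrangian L (\<mu> t) (l1_deriv T \<mu> t)) \<partial>lborel) = ennreal I" "0 \<le> I"
  shows "trunc_entropy_sum n (\<mu> T) (\<rho> T) \<le> trunc_entropy_sum n (\<mu> 0) (\<rho> 0) + I / lam"
    and "(\<integral>\<^sup>+t\<in>{0..T}. ennreal (trunc_fisher_sum L lam n (\<mu> t) (\<rho> t)) \<partial>lborel)
      \<le> ennreal (trunc_entropy_sum n (\<mu> 0) (\<rho> 0) + I / lam - trunc_entropy_sum n (\<mu> T) (\<rho> T))"
proof -
  have ac_\<rho>: "ac_curve T \<rho>" and d\<rho>: "AE t in lborel. t \<in> {0..T} \<longrightarrow> has_l1_deriv T \<rho> (transpose_gen L (pmf (\<rho> t))) t"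
    using \<rho> by (auto simp: forward_solution_def)
  define F where "F t = trunc_entropy_sum n (\<mu> t) (\<rho> t)" for t
  have dist_nonneg: "0 \<le> l1_dist q r" for q r :: "'a pmf" by (simp add: l1_dist_def l1_norm_nonneg)
  have "ac_distance T (\<lambda>u v. \<bar>F v - F u\<bar>)"
  proof (rule ac_distance_le[OF ac_distance_add[OF ac_curve_imp_ac_distance[OF \<mu>] ac_curve_imp_ac_distance[OF ac_\<rho>]]])
    show "0 < n + exp n" using n by (simp add: add_nonneg_pos)
    show "\<bar>F v - F u\<bar> \<le> (n + exp n) * (l1_dist (\<mu> v) (\<mu> u) + l1_dist (\<rho> v) (\<rho> u))" for u v
    proof -
      have "\<bar>F v - F u\<bar> \<le> n * l1_dist (\<mu> v) (\<mu> u) + exp n * l1_dist (\<rho> v) (\<rho> u)"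
        unfolding F_def by (rule trunc_entropy_sum_lipschitz[OF n])
      also have "\<dots> \<le> (n + exp n) * l1_dist (\<mu> v) (\<mu> u) + (n + exp n) * l1_dist (\<rho> v) (\<rho> u)"
        using n dist_nonneg by (intro add_mono mult_right_mono) auto
      finally show ?thesis by (simp add: distrib_left)
    qed
  qed
  then obtain f where f: "f \<in> borel_measurable borel" "integrable lborel f"
    and FTC: "\<And>a b. 0 \<le> a \<Longrightarrow> a \<le> b \<Longrightarrow> b \<le> T \<Longrightarrow> F b - F a = (LBINT t:{a..b}. f t)"
    and dF: "AE t in lborel. t \<in> {0..T} \<longrightarrow> (F has_real_derivative f t) (at t within {0..T})"
    by (rule ac_function_density[OF T]) blast

  define cl where "cl t = max 0 (min T t)" for t
  define R where "R t = trunc_fisher_sum L lam n (\<mu> (cl t)) (\<rho> (cl t))" for t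
  have [measurable]: "R \<in> borel_measurable borel"
    unfolding R_def cl_def by (rule trunc_fisher_sum_measurable[OF L lam n T \<mu> ac_\<rho>])
  have R_nonneg: "0 \<le> R t" for t
    unfolding R_def trunc_fisher_sum_def
    using trunc_fisher_term_nonneg[OF L lam n] by (intro infsum_nonneg) auto
  have R_eq: "R t = trunc_fisher_sum L lam n (\<mu> t) (\<rho> t)" if "t \<in> {0..T}" for t
    using that by (simp add: R_def cl_def)
  define f0 R0 where "f0 t = indicator {0..T} t * f t" and "R0 t = indicator {0..T} t * R t" for t
  have [measurable]: "f0 \<in> borel_measurable borel" "R0 \<in> borel_measurable borel"
    using f(1) unfolding f0_def R0_def by measurable
  have f0: "integrable lborel f0"
    using integrable_mult_indicator[OF _ f(2), of "{0..T}"] by (simp add: f0_def[abs_def])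
  have int_f0: "integral\<^sup>L lborel f0 = F T - F 0"
    using FTC[of 0 T] T by (simp add: f0_def[abs_def] set_lebesgue_integral_def)

  have "AE t in lborel. ennreal (lam * (f0 t + R0 t))
      \<le> e2ennreal (lagrangian L (\<mu> t) (l1_deriv T \<mu> t)) * indicator {0..T} t"
    using ac_curve_has_l1_deriv[OF T \<mu>] d\<rho> dF AE_lborel_singleton[of 0] AE_lborel_singleton[of T]
  proof eventually_elim
    case (elim t)
    show ?case
    proof (cases "t \<in> {0..T}")
      case True
      then have t: "0 < t" "t < T" using elim by auto
      let ?\<xi> = "\<lambda>x. trunc_log n (pmf (\<mu> t) x) (pmf (\<rho> t) x)"
      have "f t = (\<Sum>\<^sub>\<infinity>x. ?\<xi> x * l1_deriv T \<mu> t x) - (\<Sum>\<^sub>\<infinity>x. (exp (?\<xi> x) - 1) * transpose_gen L (pmf (\<rho> t)) x)"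
        using elim True by (intro trunc_entropy_sum_derivative[OF n t]) (auto simp: F_def[abs_def])
      then have "ereal (lam * (f t + R t)) \<le> lagrangian L (\<mu> t) (l1_deriv T \<mu> t)"
        using lagrangian_trunc_log_ge[OF L lam(1) n, of "\<mu> t" "\<rho> t" "l1_deriv T \<mu> t"] R_eq[OF True] by simp
      then have "ennreal (lam * (f t + R t)) \<le> e2ennreal (lagrangian L (\<mu> t) (l1_deriv T \<mu> t))"
        using e2ennreal_mono by fastforce
      then show ?thesis using True by (simp add: f0_def R0_def)
    qed (simp add: f0_def R0_def)
  qed
  from nn_integral_mono_AE[OF this]
  have upper: "(\<integral>\<^sup>+t. ennreal (lam * (f0 t + R0 t)) \<partial>lborel) \<le> ennreal I"
    using I(1) by simp

  \<comment> \<open>finiteness of the action makes the remainder integrable, so that its integral can be split off\<close>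
  have "(\<integral>\<^sup>+t. ennreal (lam * R0 t) \<partial>lborel) \<le> (\<integral>\<^sup>+t. ennreal (lam * (f0 t + R0 t)) + ennreal (norm (lam * f0 t)) \<partial>lborel)"
  proof (intro nn_integral_mono)
    fix t
    have "lam * R0 t \<le> max 0 (lam * (f0 t + R0 t)) + norm (lam * f0 t)"
    proof -
      have "lam * R0 t = lam * (f0 t + R0 t) - lam * f0 t" by (simp add: distrib_left)
      then show ?thesis unfolding real_norm_def by linarith
    qed
    then have "ennreal (lam * R0 t) \<le> ennreal (max 0 (lam * (f0 t + R0 t)) + norm (lam * f0 t))" by (rule ennreal_leI)
    also have "\<dots> = ennreal (lam * (f0 t + R0 t)) + ennreal (norm (lam * f0 t))"
      by (simp add: ennreal_plus[symmetric] ennreal_max_0 del: ennreal_plus) (simp add: ennreal_max_0 max.commute)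
    finally show "ennreal (lam * R0 t) \<le> ennreal (lam * (f0 t + R0 t)) + ennreal (norm (lam * f0 t))" .
  qed
  also have "\<dots> = (\<integral>\<^sup>+t. ennreal (lam * (f0 t + R0 t)) \<partial>lborel) + (\<integral>\<^sup>+t. ennreal (norm (lam * f0 t)) \<partial>lborel)"
    by (intro nn_integral_add) measurable
  also have "\<dots> < \<infinity>"
  proof -
    have "integrable lborel (\<lambda>t. lam * f0 t)" using f0 by simp
    then have "(\<integral>\<^sup>+t. ennreal (norm (lam * f0 t)) \<partial>lborel) < \<infinity>" by (simp only: integrable_iff_bounded)
    moreover have "(\<integral>\<^sup>+t. ennreal (lam * (f0 t + R0 t)) \<partial>lborel) < \<infinity>"
      using upper by (rule le_less_trans) simp
    ultimately show ?thesis by (simp add: ennreal_add_less_top)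
  qed
  finally have "integrable lborel (\<lambda>t. lam * R0 t)"
    using lam R_nonneg by (intro integrableI_nonneg) (auto simp: R0_def)
  then have R0: "integrable lborel R0" using lam by simp
  have R0_nonneg: "0 \<le> R0 t" for t using R_nonneg by (simp add: R0_def)

  have "lam * (F T - F 0 + integral\<^sup>L lborel R0) = integral\<^sup>L lborel (\<lambda>t. lam * (f0 t + R0 t))"
    using f0 R0 int_f0 by simp
  also have "\<dots> \<le> enn2real (\<integral>\<^sup>+t. ennreal (lam * (f0 t + R0 t)) \<partial>lborel)"
    using f0 R0 by (subst real_lebesgue_integral_def) auto
  also have "\<dots> \<le> enn2real (ennreal I)" by (rule enn2real_mono[OF upper]) simp
  finally have main: "integral\<^sup>L lborel R0 \<le> F 0 + I / lam - F T"
    using lam I(2) by (simp add: field_simps)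
  have "0 \<le> integral\<^sup>L lborel R0" using R0_nonneg by (intro integral_nonneg_AE) simp
  with main show "trunc_entropy_sum n (\<mu> T) (\<rho> T) \<le> trunc_entropy_sum n (\<mu> 0) (\<rho> 0) + I / lam"
    by (simp add: F_def)
  have "(\<integral>\<^sup>+t\<in>{0..T}. ennreal (trunc_fisher_sum L lam n (\<mu> t) (\<rho> t)) \<partial>lborel) = (\<integral>\<^sup>+t. ennreal (R0 t) \<partial>lborel)"
    by (intro nn_integral_cong) (auto simp: R0_def R_eq indicator_def)
  also have "\<dots> = ennreal (integral\<^sup>L lborel R0)"
    using R0 R0_nonneg by (intro nn_integral_eq_integral) auto
  finally show "(\<integral>\<^sup>+t\<in>{0..T}. ennreal (trunc_fisher_sum L lam n (\<mu> t) (\<rho> t)) \<partial>lborel)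
      \<le> ennreal (trunc_entropy_sum n (\<mu> 0) (\<rho> 0) + I / lam - trunc_entropy_sum n (\<mu> T) (\<rho> T))"
    using main by (simp add: F_def ennreal_leI)
qed

text \<open>Fatou's lemma in time. The endpoints of \<open>[0, T]\<close> form a null set, and at interior times the
  forward equation provides the vanishing rates.\<close>

lemma fisher_info_integral_le:
  fixes L :: "'a::countable \<Rightarrow> 'a \<Rightarrow> real" and \<mu> \<rho> :: "real \<Rightarrow> 'a pmf"
  assumes T: "0 < T" and L: "generator L" and \<rho>: "forward_solution L T \<rho>" and \<mu>: "ac_curve T \<mu>"
    and lam: "0 < lam" "lam < 1"
  shows "(\<integral>\<^sup>+t\<in>{0..T}. e2ennreal (fisher_info L lam (\<mu> t) (\<rho> t)) \<partial>lborel)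
    \<le> liminf (\<lambda>k. \<integral>\<^sup>+t\<in>{0..T}. ennreal (trunc_fisher_sum L lam (real k) (\<mu> t) (\<rho> t)) \<partial>lborel)"
proof -
  define cl where "cl t = max 0 (min T t)" for t
  define R where "R k t = ennreal (trunc_fisher_sum L lam (real k) (\<mu> (cl t)) (\<rho> (cl t))) * indicator {0..T} t" for k :: nat and t
  have ac_\<rho>: "ac_curve T \<rho>" and d\<rho>: "AE t in lborel. t \<in> {0..T} \<longrightarrow> has_l1_deriv T \<rho> (transpose_gen L (pmf (\<rho> t))) t"
    using \<rho> by (auto simp: forward_solution_def)
  have R_meas: "R k \<in> borel_measurable lborel" for k
  proof -
    have [measurable]: "(\<lambda>t. trunc_fisher_sum L lam (real k) (\<mu> (cl t)) (\<rho> (cl t))) \<in> borel_measurable borel"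
      unfolding cl_def by (rule trunc_fisher_sum_measurable[OF L lam _ T \<mu> ac_\<rho>]) simp
    show ?thesis unfolding R_def by measurable
  qed
  have "AE t in lborel. e2ennreal (fisher_info L lam (\<mu> t) (\<rho> t)) * indicator {0..T} t \<le> liminf (\<lambda>k. R k t)"
    using d\<rho> AE_lborel_singleton[of 0] AE_lborel_singleton[of T]
  proof eventually_elim
    case (elim t)
    show ?case
    proof (cases "t \<in> {0..T}")
      case True
      then have t: "0 < t" "t < T" using elim by auto
      have "cl t = t" using True by (simp add: cl_def)
      then show ?thesis
        using fisher_info_le_liminf[OF L lam forward_equation_vanishing[OF L t]] elim True
        by (simp add: R_def)
    qed simp
  qed
  then have "(\<integral>\<^sup>+t\<in>{0..T}. e2ennreal (fisher_info L lam (\<mu> t) (\<rho> t)) \<partial>lborel) \<le> (\<integral>\<^sup>+t. liminf (\<lambda>k. R k t) \<partial>lborel)"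
    by (rule nn_integral_mono_AE)
  also have "\<dots> \<le> liminf (\<lambda>k. \<integral>\<^sup>+t. R k t \<partial>lborel)"
    by (rule nn_integral_liminf[OF R_meas])
  also have "(\<lambda>k. \<integral>\<^sup>+t. R k t \<partial>lborel) = (\<lambda>k. \<integral>\<^sup>+t\<in>{0..T}. ennreal (trunc_fisher_sum L lam (real k) (\<mu> t) (\<rho> t)) \<partial>lborel)"
    by (intro ext nn_integral_cong) (auto simp: R_def cl_def indicator_def)
  finally show ?thesis .
qed

text \<open>In the limit the entropy at time \<open>T\<close> and the integral of the Fisher information must be bounded
  together, not one at a time. Therefore the entropy sum is first restricted to a finite set of
  states: there it converges, and what remains of the bound dominates the lower limit of the
  integrals. The supremum over finite sets comes last.\<close>

theorem theorem1p5:
  fixes L :: "'a::countable \<Rightarrow> 'a \<Rightarrow> real"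
    and T lam :: real
    and \<rho> \<mu> :: "real \<Rightarrow> 'a pmf"
  assumes "T > 0"
    and "generator L"
    and "forward_solution L T \<rho>"
    and "cont_curve T \<mu>"
    and "rate_functional L T \<mu> + rel_entropy (\<mu> 0) (\<rho> 0) < \<infinity>"
    and "0 < lam" and "lam < 1"
  shows "rel_entropy (\<mu> T) (\<rho> T)
           + enn2ereal (\<integral>\<^sup>+t\<in>{0..T}. e2ennreal (fisher_info L lam (\<mu> t) (\<rho> t)) \<partial>lborel)
         \<le> rel_entropy (\<mu> 0) (\<rho> 0) + ereal (1 / lam) * rate_functional L T \<mu>"
proof -
  note T = assms(1) and L = assms(2) and \<rho> = assms(3) and finite = assms(5) and lam = assms(6,7)
  have rate_nonneg: "0 \<le> rate_functional L T \<mu>" by (simp add: rate_functional_def)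
  obtain H where H: "rel_entropy (\<mu> 0) (\<rho> 0) = ereal H"
    using finite rate_nonneg by (cases rule: rel_entropy_real_cases[of "\<mu> 0" "\<rho> 0"]) auto
  have rate_finite: "rate_functional L T \<mu> \<noteq> \<infinity>" using finite H by auto
  then have \<mu>: "ac_curve T \<mu>" by (auto simp: rate_functional_def split: if_splits)
  let ?I = "\<integral>\<^sup>+t\<in>{0..T}. e2ennreal (lagrangian L (\<mu> t) (l1_deriv T \<mu> t)) \<partial>lborel"
  have rate: "rate_functional L T \<mu> = enn2ereal ?I" using \<mu> by (simp add: rate_functional_def)
  then have "?I \<noteq> top" using rate_finite by auto
  then obtain I where I: "?I = ennreal I" "0 \<le> I" by (cases ?I rule: ennreal_cases) auto
  define B where "B = H + I / lam"
  let ?F = "\<lambda>k. trunc_entropy_sum (real k) (\<mu> T) (\<rho> T)"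
  let ?R = "\<lambda>k. \<integral>\<^sup>+t\<in>{0..T}. ennreal (trunc_fisher_sum L lam (real k) (\<mu> t) (\<rho> t)) \<partial>lborel"
  let ?J = "\<integral>\<^sup>+t\<in>{0..T}. e2ennreal (fisher_info L lam (\<mu> t) (\<rho> t)) \<partial>lborel"
  have F_le: "?F k \<le> B" and R_le: "?R k \<le> ennreal (B - ?F k)" for k
  proof -
    note tr = trunc_inequality[OF T L \<rho> \<mu> lam _ I, of "real k"]
    have "trunc_entropy_sum (real k) (\<mu> 0) (\<rho> 0) \<le> H" by (rule trunc_entropy_sum_le[OF H]) simp
    then show "?F k \<le> B" "?R k \<le> ennreal (B - ?F k)"
      using tr(1) order_trans[OF tr(2) ennreal_leI] by (auto simp: B_def)
  qed
  have partial: "(\<Sum>x\<in>A. trunc_entropy (real k) (pmf (\<mu> T) x) (pmf (\<rho> T) x)) \<le> ?F k" if "finite A" for A k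
    unfolding trunc_entropy_sum_def
    using that by (intro finite_sum_le_infsum trunc_entropy_summable) (auto simp: trunc_entropy_nonneg)

  \<comment> \<open>a state with \<open>r = 0 < m\<close> has truncated entropy \<open>n m\<close>, unbounded in \<open>n\<close>\<close>
  have abs_cont: "\<forall>x. pmf (\<rho> T) x = 0 \<longrightarrow> pmf (\<mu> T) x = 0"
  proof (intro allI impI, rule ccontr)
    fix x assume x: "pmf (\<rho> T) x = 0" "pmf (\<mu> T) x \<noteq> 0"
    obtain k :: nat where k: "B / pmf (\<mu> T) x < real k" using reals_Archimedean2 by blast
    have "trunc_entropy (real k) (pmf (\<mu> T) x) 0 = pmf (\<mu> T) x * real k"
      by (simp add: trunc_entropy_def trunc_log_def)
    then have "pmf (\<mu> T) x * real k \<le> B"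
      using partial[of "{x}" k] F_le[of k] x(1) by simp
    then show False using k x(2) pmf_pos[OF x(2)] by (simp add: field_simps)
  qed
  define S where "S A = (\<Sum>x\<in>A. pmf (\<mu> T) x * ln (pmf (\<mu> T) x / pmf (\<rho> T) x) - pmf (\<mu> T) x + pmf (\<rho> T) x)" for A
  have S_lim: "(\<lambda>k. \<Sum>x\<in>A. trunc_entropy (real k) (pmf (\<mu> T) x) (pmf (\<rho> T) x)) \<longlonglongrightarrow> S A" for A
    unfolding S_def
  proof (rule tendsto_sum)
    fix x
    show "(\<lambda>k. trunc_entropy (real k) (pmf (\<mu> T) x) (pmf (\<rho> T) x))
        \<longlonglongrightarrow> pmf (\<mu> T) x * ln (pmf (\<mu> T) x / pmf (\<rho> T) x) - pmf (\<mu> T) x + pmf (\<rho> T) x"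
      using abs_cont trunc_entropy_tendsto[of "pmf (\<mu> T) x" "pmf (\<rho> T) x"] pmf_pos[of "\<rho> T" x]
      by (cases "pmf (\<rho> T) x = 0") (auto simp: trunc_entropy_def)
  qed
  have S_le: "S A \<le> B" if A: "finite A" for A
    by (rule LIMSEQ_le_const2[OF S_lim]) (use order_trans[OF partial[OF A] F_le] in blast)
  have J_le: "?J \<le> ennreal (B - S A)" if A: "finite A" for A
  proof -
    have "?J \<le> liminf ?R" by (rule fisher_info_integral_le[OF T L \<rho> \<mu> lam])
    also have "\<dots> \<le> liminf (\<lambda>k. ennreal (B - (\<Sum>x\<in>A. trunc_entropy (real k) (pmf (\<mu> T) x) (pmf (\<rho> T) x))))"
    proof (intro Liminf_mono always_eventually allI)
      fix k
      show "?R k \<le> ennreal (B - (\<Sum>x\<in>A. trunc_entropy (real k) (pmf (\<mu> T) x) (pmf (\<rho> T) x)))"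
        using R_le[of k] by (rule order_trans) (use partial[OF A] in \<open>simp add: ennreal_leI\<close>)
    qed
    also have "\<dots> = ennreal (B - S A)"
      by (intro lim_imp_Liminf sequentially_bot tendsto_ennrealI tendsto_diff tendsto_const S_lim)
    finally show ?thesis .
  qed
  have "?J \<noteq> top" using J_le[of "{}"] by (auto simp: top_unique)
  then obtain j where j: "?J = ennreal j" "0 \<le> j" by (cases ?J rule: ennreal_cases) auto
  have "S A \<le> B - j" if A: "finite A" for A
    using J_le[OF A] j S_le[OF A] by (simp add: ennreal_le_iff)
  then have "rel_entropy (\<mu> T) (\<rho> T) \<le> ereal (B - j)"
    unfolding S_def by (rule rel_entropy_le[OF abs_cont])
  then have "rel_entropy (\<mu> T) (\<rho> T) + enn2ereal ?J \<le> ereal (B - j) + ereal j"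
    using j by (intro add_mono) auto
  also have "\<dots> = rel_entropy (\<mu> 0) (\<rho> 0) + ereal (1 / lam) * rate_functional L T \<mu>"
    using rate I H by (simp add: B_def)
  finally show ?thesis .
qed

end
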